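(* Let $F,G\in\mathcal B_{\log}$ be quasiconformally equivalent, $\Psi\circ F=G\circ\Phi$. Then for every $Q>0$ there is $Q'\ge Q$ with the following property. Suppose that $\Pi_1,\Pi_2:J_Q(F)\to J(G)$ are continuous functions such that each $\Pi\in\{\Pi_1,\Pi_2\}$ satisfies: 1. $\Pi\circ F=G\circ\Pi$; 2. $\Pi(z)\to\infty$ as $z\to\infty$; 3. $\Pi(z+2\pi i)=\Pi(z)+2\pi i$; 4. for every $z\in J_Q(F)$, the points $\Pi(z)$ and $\Phi(z)$ belong to the same tract of $G$. Then $\Pi_1(z)=\Pi_2(z)$ for all $z\in J_{Q'}(F)$.
   Context: Closures and boundaries are taken in $\mathbb C$ unless stated otherwise. $\mathbb H_R=\{\operatorname{Re}z>R\}$. An unbounded Jordan domain is a domain in $\mathbb C$ whose boundary on the Riemann sphere is a Jordan curve passing through $\infty$. $\mathcal B_{\log}$ is the class of all functions $F:\mathcal V\to H$ such that: (A) $H$ is a $2\pi i$-periodic unbounded Jordan domain containing a right half-plane; (B) $\mathcal V\ne\emptyset$ is open and $2\pi i$-periodic, and $\operatorname{Re}z$ is bounded from below in $\mathcal V$; (C) $F$ is $2\pi i$-periodic; (D) each component $T$ of $\mathcal V$ (called a tract of $F$) is an unbounded Jordan domain disjoint from all its translates by nonzero elements of $2\pi i\mathbb Z$, and $F:T\to H$ is a conformal isomorphism with $F(\infty)=\infty$; (E) if $z_n\in\mathcal V$ is a sequence of points all belonging to different components of $\mathcal V$, then $z_n\to\infty$. Any such $F$ extends continuously to $\overline{\mathcal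 V}$. For $F\in\mathcal B_{\log}$ put $J(F)=\{z\in\overline{\mathcal V}:F^n(z)\in\overline{\mathcal V}\ \forall n\ge0\}$ and $J_Q(F)=\{z\in J(F):\operatorname{Re}F^n(z)\ge Q\ \forall n\ge1\}$. Functions $F,G\in\mathcal B_{\log}$ with domains $\mathcal V,\mathcal W$ are quasiconformally equivalent if there are quasiconformal maps $\Phi,\Psi:\mathbb C\to\mathbb C$ such that: $\Phi$ and $\Psi$ commute with $z\mapsto z+2\pi i$; $\operatorname{Re}\Phi(z)\to\pm\infty$ as $\operatorname{Re}z\to\pm\infty$, and similarly for $\Psi$; for sufficiently large $R$, $\Phi(F^{-1}(\mathbb H_R))\subset\mathcal W$ and $\Phi^{-1}(G^{-1}(\mathbb H_R))\subset\mathcal V$; and $\Psi\circ F=G\circ\Phi$ wherever both compositions are defined. In the claim, $\Phi,\Psi$ are fixed maps of this kind. *)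

theory Defs
  imports "HOL-Complex_Analysis.Complex_Analysis"
begin

definition right_half_plane :: "real \<Rightarrow> complex set" where
  "right_half_plane R = {z. Re z > R}"

abbreviation two_pi_i :: complex where
  "two_pi_i \<equiv> complex_of_real (2 * pi) * \<i>"

definition periodic_set :: "complex set \<Rightarrow> bool" where
  "periodic_set S \<longleftrightarrow> (\<forall>z. z + two_pi_i \<in> S \<longleftrightarrow> z \<in> S)"


subsection \<open>Unbounded Jordan domains\<close>

text \<open>The Riemann sphere is the one-point compactification of the plane, with \<^term>\<open>None\<close> as the
  point at infinity.\<close>

abbreviation riemann_sphere :: "complex option topology" where
  "riemann_sphere \<equiv> Alexandroff_compactification euclidean"

definition unbounded_jordan_domain :: "complex set \<Rightarrow> bool" where
  "unbounded_jordan_domain D \<longleftrightarrow>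
     D \<noteq> {} \<and> open D \<and> connected D \<and>
     (let B = riemann_sphere frontier_of (Some ` D) in
        subtopology riemann_sphere B homeomorphic_space top_of_set (sphere (0::complex) 1) \<and>
        None \<in> B)"


subsection \<open>The class of logarithmic transforms\<close>

text \<open>A member of the class is given by its domain \<open>V\<close>, its codomain \<open>H\<close> and a map \<open>F\<close> whose
  values outside \<open>V\<close> are irrelevant. The normalisation \<open>F(\<infinity>) = \<infinity>\<close> refers to the extension of \<open>F\<close>
  to the closure of the tract in the sphere, so it says that \<open>F z\<close> tends to infinity as \<open>z\<close> tends to
  infinity inside the tract.\<close>

definition conformal_isomorphism_fixing_infinity ::
    "(complex \<Rightarrow> complex) \<Rightarrow> complex set \<Rightarrow> complex set \<Rightarrow> bool" where
  "conformal_isomorphism_fixing_infinity F T H \<longleftrightarrow>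
     F holomorphic_on T \<and> bij_betw F T H \<and>
     filterlim F at_infinity (inf at_infinity (principal T))"

definition B_log :: "complex set \<Rightarrow> complex set \<Rightarrow> (complex \<Rightarrow> complex) \<Rightarrow> bool" where
  "B_log V H F \<longleftrightarrow>
     (periodic_set H \<and> unbounded_jordan_domain H \<and> (\<exists>R. right_half_plane R \<subseteq> H)) \<and>
     (V \<noteq> {} \<and> open V \<and> periodic_set V \<and> bdd_below (Re ` V)) \<and>
     (\<forall>z\<in>V. F (z + two_pi_i) = F z) \<and>
     (\<forall>T\<in>components V.
        unbounded_jordan_domain T \<and>
        (\<forall>k::int. k \<noteq> 0 \<longrightarrow> T \<inter> (\<lambda>z. z + of_int k * two_pi_i) ` T = {}) \<and>
        conformal_isomorphism_fixing_infinity F T H) \<and>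
     (\<forall>z :: nat \<Rightarrow> complex.
        (\<forall>n. z n \<in> V) \<and>
        (\<forall>m n. m \<noteq> n \<longrightarrow>
           connected_component_set V (z m) \<noteq> connected_component_set V (z n)) \<longrightarrow>
        filterlim z at_infinity sequentially)"


subsection \<open>Continuous extension to the closure and Julia sets\<close>

text \<open>\<open>ext_dom V F\<close> consists of the points of the closure of \<open>V\<close> to which \<open>F\<close> extends by
  continuity. It equals \<^term>\<open>closure V\<close> whenever \<open>F\<close> has a continuous extension to the closure.
  Iterates are required to stay in \<open>ext_dom V F\<close> so that \<^term>\<open>Lim\<close> is never used where the
  limit does not exist: if two tracts share a boundary point, the boundary values of \<open>F\<close> from the
  two sides need not agree there.\<close>

definition ext_dom :: "complex set \<Rightarrow> (complex \<Rightarrow> complex) \<Rightarrow> complex set" where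
  "ext_dom V F = V \<union> {z \<in> closure V. \<exists>l. (F \<longlongrightarrow> l) (at z within V)}"

definition ext :: "complex set \<Rightarrow> (complex \<Rightarrow> complex) \<Rightarrow> complex \<Rightarrow> complex" where
  "ext V F z = (if z \<in> V then F z else Lim (at z within V) F)"

definition J :: "complex set \<Rightarrow> (complex \<Rightarrow> complex) \<Rightarrow> complex set" where
  "J V F = {z. \<forall>n. (ext V F ^^ n) z \<in> ext_dom V F}"

definition J_above :: "real \<Rightarrow> complex set \<Rightarrow> (complex \<Rightarrow> complex) \<Rightarrow> complex set" where
  "J_above Q V F = {z \<in> J V F. \<forall>n\<ge>1. Re ((ext V F ^^ n) z) \<ge> Q}"

lemma ext_dom_eq_closure:
  assumes "continuous_on (closure V) g" and "\<And>z. z \<in> V \<Longrightarrow> g z = F z"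
  shows "ext_dom V F = closure V"
proof -
  have "(F \<longlongrightarrow> g z) (at z within V)" if "z \<in> closure V" for z
  proof -
    have "(g \<longlongrightarrow> g z) (at z within V)"
      using assms(1) that closure_subset
      by (metis continuous_on_def tendsto_within_subset)
    then show ?thesis
      by (rule Lim_transform_eventually) (auto simp: eventually_at_filter assms(2))
  qed
  then show ?thesis
    unfolding ext_dom_def using closure_subset by blast
qed

lemma ext_eq_continuous_extension:
  assumes "continuous_on (closure V) g" and "\<And>z. z \<in> V \<Longrightarrow> g z = F z" and "z \<in> closure V"
  shows "ext V F z = g z"
proof (cases "z \<in> V")
  case True
  then show ?thesis by (simp add: ext_def assms(2))
next
  case False
  then have nontriv: "at z within V \<noteq> bot"
    using assms(3) by (metis closure_def islimpt_in_closure trivial_limit_within Diff_empty Diff_insert0)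
  have "(g \<longlongrightarrow> g z) (at z within V)"
    using assms(1,3) closure_subset
    by (metis continuous_on_def tendsto_within_subset)
  then have "(F \<longlongrightarrow> g z) (at z within V)"
    by (rule Lim_transform_eventually) (auto simp: eventually_at_filter assms(2))
  then show ?thesis
    using nontriv False by (simp add: ext_def tendsto_Lim)
qed


subsection \<open>Quasiconformal maps\<close>

definition absolutely_continuous_on_interval ::
    "(real \<Rightarrow> complex) \<Rightarrow> real \<Rightarrow> real \<Rightarrow> bool" where
  "absolutely_continuous_on_interval f a b \<longleftrightarrow>
     (\<forall>\<epsilon>>0. \<exists>\<delta>>0. \<forall>(n::nat) s t.
        (\<forall>i<n. a \<le> s i \<and> s i \<le> t i \<and> t i \<le> b) \<and>
        (\<forall>i<n. \<forall>j<n. i \<noteq> j \<longrightarrow> {s i<..<t i} \<inter> {s j<..<t j} = {}) \<and>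
        (\<Sum>i<n. t i - s i) < \<delta> \<longrightarrow>
        (\<Sum>i<n. cmod (f (t i) - f (s i))) < \<epsilon>)"

definition ACL :: "(complex \<Rightarrow> complex) \<Rightarrow> bool" where
  "ACL f \<longleftrightarrow>
     (AE y in lborel. \<forall>a b. absolutely_continuous_on_interval (\<lambda>x. f (Complex x y)) a b) \<and>
     (AE x in lborel. \<forall>a b. absolutely_continuous_on_interval (\<lambda>y. f (Complex x y)) a b)"

text \<open>Ahlfors' analytic definition: a homeomorphism that is absolutely continuous on lines and
  satisfies \<open>|f_zbar| \<le> k |f_z|\<close> almost everywhere for some \<open>k < 1\<close>, that is, \<open>K\<close>-quasiconformality
  with \<open>K = (1 + k) / (1 - k)\<close>. Here \<open>fx\<close> and \<open>fy\<close> are the partial derivatives, so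
  \<open>fx + \<i> fy\<close> and \<open>fx - \<i> fy\<close> are twice the derivatives of \<open>f\<close> with respect to \<open>zbar\<close> and \<open>z\<close>.
  The inequality forces \<open>f\<close> to preserve orientation.\<close>

definition quasiconformal :: "(complex \<Rightarrow> complex) \<Rightarrow> bool" where
  "quasiconformal f \<longleftrightarrow>
     (\<exists>g. homeomorphism UNIV UNIV f g) \<and> ACL f \<and>
     (\<exists>k. 0 \<le> k \<and> k < 1 \<and>
        (AE z in lborel. \<exists>fx fy.
           ((\<lambda>t. f (z + of_real t)) has_vector_derivative fx) (at 0) \<and>
           ((\<lambda>t. f (z + \<i> * of_real t)) has_vector_derivative fy) (at 0) \<and>
           cmod (fx + \<i> * fy) \<le> k * cmod (fx - \<i> * fy)))"


subsection \<open>Quasiconformal equivalence\<close>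

definition equivalence_map :: "(complex \<Rightarrow> complex) \<Rightarrow> bool" where
  "equivalence_map \<Phi> \<longleftrightarrow>
     quasiconformal \<Phi> \<and>
     (\<forall>z. \<Phi> (z + two_pi_i) = \<Phi> z + two_pi_i) \<and>
     filterlim (\<lambda>z. Re (\<Phi> z)) at_top (filtercomap Re at_top) \<and>
     filterlim (\<lambda>z. Re (\<Phi> z)) at_bot (filtercomap Re at_bot)"

definition qc_equivalent_via ::
    "complex set \<Rightarrow> (complex \<Rightarrow> complex) \<Rightarrow> complex set \<Rightarrow> (complex \<Rightarrow> complex) \<Rightarrow>
     (complex \<Rightarrow> complex) \<Rightarrow> (complex \<Rightarrow> complex) \<Rightarrow> bool" where
  "qc_equivalent_via V F W G \<Phi> \<Psi> \<longleftrightarrow>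
     equivalence_map \<Phi> \<and> equivalence_map \<Psi> \<and>
     (\<forall>\<^sub>F R in at_top. \<Phi> ` {z \<in> V. F z \<in> right_half_plane R} \<subseteq> W \<and>
                     \<Phi> -` {w \<in> W. G w \<in> right_half_plane R} \<subseteq> V) \<and>
     (\<forall>z\<in>V. \<Phi> z \<in> W \<longrightarrow> \<Psi> (F z) = G (\<Phi> z))"


subsection \<open>Semiconjugacies\<close>

definition admissible_semiconjugacy ::
    "real \<Rightarrow> complex set \<Rightarrow> (complex \<Rightarrow> complex) \<Rightarrow> complex set \<Rightarrow> (complex \<Rightarrow> complex) \<Rightarrow>
     (complex \<Rightarrow> complex) \<Rightarrow> (complex \<Rightarrow> complex) \<Rightarrow> bool" where
  "admissible_semiconjugacy Q V F W G \<Phi> P \<longleftrightarrow>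
     continuous_on (J_above Q V F) P \<and> P ` J_above Q V F \<subseteq> J W G \<and>
     (\<forall>z\<in>J_above Q V F. P (ext V F z) = ext W G (P z)) \<and>
     filterlim P at_infinity (inf at_infinity (principal (J_above Q V F))) \<and>
     (\<forall>z\<in>J_above Q V F. P (z + two_pi_i) = P z + two_pi_i) \<and>
     (\<forall>z\<in>J_above Q V F. \<exists>T\<in>components W. P z \<in> T \<and> \<Phi> z \<in> T)"

end

theory Submission
  imports Defs "HOL-Real_Asymp.Real_Asymp"
begin

text \<open>
  Two semiconjugacies \<open>P\<^sub>1\<close>, \<open>P\<^sub>2\<close> are compared on the set \<open>E\<close> of points where they agree. This set is closed in the
  domain of the maps, and it is backward invariant under \<open>F\<close>, because \<open>P\<^sub>1 z\<close> and \<open>P\<^sub>2 z\<close> lie in the tract of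
  \<open>G\<close> that contains \<open>\<Phi> z\<close> and \<open>G\<close> is injective on tracts. So it suffices to find enough points of \<open>E\<close>.

  A point \<open>p\<close> with \<open>F p = p + 2\<pi>\<i>k\<close> is mapped by both maps to a point \<open>u\<close> with \<open>G u = u + 2\<pi>\<i>k\<close>, that is,
  to a fixed point of a translated inverse branch of \<open>G\<close>. Inverse branches contract where real parts
  are large (\<open>branch_contraction\<close>), and \<open>Re (P\<^sub>i p)\<close> is large when \<open>Re p\<close> is
  (\<open>semiconjugacy_Re_large\<close>), so \<open>p \<in> E\<close> as soon as \<open>Re p\<close> exceeds a bound \<open>\<rho>\<close>. This bound depends on
  \<open>P\<^sub>1\<close> and \<open>P\<^sub>2\<close>, while \<open>Q'\<close> must not. The gap is closed by backward invariance. From any point of real part at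
  least \<open>Q'\<close> a finite pseudo-orbit that doubles the real part in each step leads to one of the points \<open>p\<close>;
  pulling \<open>p\<close> back along it, and then along the first \<open>n\<close> points of a given orbit in \<open>J_Q'\<close>, gives a
  point of \<open>E\<close> at distance at most a constant times \<open>4\<close> to the power \<open>-n\<close> from the beginning of that orbit
  (\<open>backward_invariant_set_accumulates\<close>, \<open>backward_invariant_set_dense\<close>). Hence \<open>J_Q'\<close> lies in the closure of \<open>E\<close>.

  For the pseudo-orbits and the points \<open>p\<close> one needs points of prescribed large real part whose images
  have prescribed large real part. Equivalently, the real part of an inverse branch \<open>f\<close> of \<open>F\<close> takes all large values on
  each vertical line far enough to the right. The essential point is that it is unbounded on such a line
  (\<open>branch_unbounded_on_vertical_line\<close>). It would follow from Caratheodory's theorem on boundary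
  extension, but a weaker argument in the style of Lindelof is enough. Since a tract \<open>T\<close> is a Jordan
  domain, its part far out is essentially connected
  (\<open>unbounded_jordan_domain_connected_at_infinity\<close>). The image of this part under \<open>F\<close> is connected, reaches
  infinity, and carries large values of \<open>Re f\<close>. If \<open>Re f\<close> were bounded on a vertical line, the image would have to
  escape vertically to the left of the line (to the right of it \<open>Re f\<close> is bounded as well, by
  \<open>phragmen_lindelof_right_half_plane\<close>). As \<open>H\<close> is periodic and its frontier is connected by paths, the
  frontier cannot enter between the image and the line (\<open>component_below_path_subset_domain\<close>), and
  a two-constants estimate carries the large values over to the line (\<open>lower_bound_beside_path\<close>).
\<close>

section \<open>Unbounded Jordan domains near infinity\<close>

lemma Some_mem_frontier_of_riemann_sphere:
  "Some x \<in> riemann_sphere frontier_of (Some ` D) \<longleftrightarrow> x \<in> frontier D"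
proof -
  have cl: "Some x \<in> riemann_sphere closure_of (Some ` S) \<longleftrightarrow> x \<in> closure S" for S
  proof
    assume L: "Some x \<in> riemann_sphere closure_of (Some ` S)"
    show "x \<in> closure S"
      unfolding closure_iff_nhds_not_empty
    proof (intro allI impI notI)
      fix A U assume "U \<subseteq> A" "open U" "x \<in> U" "S \<inter> A = {}"
      have "openin riemann_sphere (Some ` U)" using \<open>open U\<close> by simp
      with L \<open>x \<in> U\<close> obtain y where "y \<in> Some ` S" "y \<in> Some ` U"
        unfolding in_closure_of by blast
      with \<open>S \<inter> A = {}\<close> \<open>U \<subseteq> A\<close> show False by auto
    qed
  next
    assume R: "x \<in> closure S"
    show "Some x \<in> riemann_sphere closure_of (Some ` S)"
      unfolding in_closure_of
    proof (intro conjI allI impI)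
      show "Some x \<in> topspace riemann_sphere" by simp
      fix T assume T: "Some x \<in> T \<and> openin riemann_sphere T"
      then have "openin euclidean {y. Some y \<in> T}"
        using openin_continuous_map_preimage[OF continuous_map_Some, of euclidean T] by simp
      then have "open {y. Some y \<in> T}" by simp
      then show "\<exists>y. y \<in> Some ` S \<and> y \<in> T"
        using R T unfolding closure_iff_nhds_not_empty by blast
    qed
  qed
  have "topspace riemann_sphere - Some ` D = insert None (Some ` (- D))" by auto
  moreover have "riemann_sphere closure_of (insert None (Some ` (- D)))
      = riemann_sphere closure_of {None} \<union> riemann_sphere closure_of (Some ` (- D))"
    by (metis closure_of_Un insert_is_Un)
  moreover have "riemann_sphere closure_of {None} = {None}"
    by (rule closure_of_closedin) (auto simp: closedin_Alexandroff_compactification intro!: exI[of _ UNIV])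
  ultimately have "Some x \<in> riemann_sphere closure_of (topspace riemann_sphere - Some ` D)
      \<longleftrightarrow> x \<in> closure (- D)"
    by (simp add: cl)
  then show ?thesis
    by (simp add: frontier_of_closures frontier_closures cl Compl_eq_Diff_UNIV)
qed

lemma unbounded_jordan_domain_unbounded:
  assumes "unbounded_jordan_domain D"
  shows "\<not> bounded D"
proof
  assume "bounded D"
  then obtain r where r: "D \<subseteq> cball 0 r" by (auto simp: bounded_iff subset_iff)
  have N: "None \<in> riemann_sphere closure_of (Some ` D)"
    using assms unfolding unbounded_jordan_domain_def Let_def frontier_of_closures by blast
  have "openin riemann_sphere (insert None (Some ` (topspace euclidean - cball 0 r)))"
    unfolding openin_Alexandroff_compactification
    by (intro disjI2 exI[of _ "cball 0 r"]) auto
  with N obtain y where "y \<in> Some ` D" "y \<in> insert None (Some ` (topspace euclidean - cball 0 r))"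
    unfolding in_closure_of by blast
  with r show False by auto
qed

lemma top_of_set_homeomorphic_space_iff:
  "top_of_set S homeomorphic_space top_of_set T \<longleftrightarrow> S homeomorphic T"
proof
  assume "top_of_set S homeomorphic_space top_of_set T"
  then obtain f g where "homeomorphic_maps (top_of_set S) (top_of_set T) f g"
    by (auto simp: homeomorphic_space_def)
  then have "homeomorphism S T f g"
    by (auto simp: homeomorphic_maps_def homeomorphism_def image_iff Pi_iff) (metis)+
  then show "S homeomorphic T" by (auto simp: homeomorphic_def)
next
  assume "S homeomorphic T"
  then obtain f g where "homeomorphism S T f g" by (auto simp: homeomorphic_def)
  then have "homeomorphic_maps (top_of_set S) (top_of_set T) f g"
    by (auto simp: homeomorphic_maps_def homeomorphism_def)
  then show "top_of_set S homeomorphic_space top_of_set T" by (auto simp: homeomorphic_space_def)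
qed

text \<open>The frontier in the sphere is a circle through the point at infinity. The frontier in the plane is
  what remains of it when that point is removed, and a punctured circle is a line.\<close>

lemma frontier_unbounded_jordan_domain_homeomorphic_line:
  assumes "unbounded_jordan_domain D"
  shows "frontier D homeomorphic (UNIV :: real set)"
proof -
  define B where "B = riemann_sphere frontier_of (Some ` D)"
  have "subtopology riemann_sphere B homeomorphic_space top_of_set (sphere (0::complex) 1)"
    and NB: "None \<in> B"
    using assms by (auto simp: unbounded_jordan_domain_def Let_def B_def)
  then obtain g where g: "homeomorphic_map (subtopology riemann_sphere B) (top_of_set (sphere (0::complex) 1)) g"
    by (auto simp: homeomorphic_space)
  have Bsub: "B \<subseteq> topspace riemann_sphere"
    unfolding B_def by (rule frontier_of_subset_topspace)
  have Beq: "B = insert None (Some ` frontier D)"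
  proof (intro set_eqI)
    fix v show "v \<in> B \<longleftrightarrow> v \<in> insert None (Some ` frontier D)"
      using NB Some_mem_frontier_of_riemann_sphere[of _ D] by (cases v) (auto simp: B_def)
  qed
  define p where "p = g None"
  have inj: "inj_on g B" and im: "g ` B = sphere 0 1"
    using g Bsub by (auto simp: homeomorphic_eq_everything_map topspace_subtopology Int_absorb1)
  have p: "p \<in> sphere 0 1" using im NB p_def by blast
  have "homeomorphic_map (subtopology (subtopology riemann_sphere B) (Some ` frontier D))
      (subtopology (top_of_set (sphere (0::complex) 1)) (sphere 0 1 - {p})) g"
  proof (rule homeomorphic_map_subtopologies_alt[OF g])
    fix x assume "x \<in> topspace (subtopology riemann_sphere B)" "g x \<in> topspace (top_of_set (sphere (0::complex) 1))"
    then have "x \<in> B" by (simp add: topspace_subtopology)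
    then have "g x \<in> sphere 0 1" using im by blast
    have "g x = p \<longleftrightarrow> x = None" using inj \<open>x \<in> B\<close> NB unfolding p_def by (auto dest: inj_onD)
    then show "(g x \<in> sphere 0 1 - {p}) = (x \<in> Some ` frontier D)"
      using \<open>g x \<in> sphere 0 1\<close> \<open>x \<in> B\<close> Beq by (cases x) auto
  qed
  then have "subtopology riemann_sphere (Some ` frontier D) homeomorphic_space top_of_set (sphere (0::complex) 1 - {p})"
    using Beq by (auto simp: subtopology_subtopology homeomorphic_space Int_absorb1 Int_absorb2 subset_insertI)
  moreover have "subtopology euclidean (frontier D) homeomorphic_space subtopology riemann_sphere (Some ` frontier D)"
  proof -
    have "homeomorphic_map euclidean (subtopology riemann_sphere (range Some)) (Some :: complex \<Rightarrow> _)"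
      using embedding_map_Some[of "euclidean :: complex topology"] by (simp add: embedding_map_def)
    then have "homeomorphic_map (subtopology euclidean (frontier D))
        (subtopology (subtopology riemann_sphere (range Some)) (Some ` frontier D)) Some"
      by (rule homeomorphic_map_subtopologies_alt) auto
    moreover have "range Some \<inter> Some ` frontier D = Some ` frontier D" by auto
    ultimately show ?thesis
      by (auto simp: subtopology_subtopology homeomorphic_space)
  qed
  moreover have "(sphere (0::complex) 1 - {p}) homeomorphic (UNIV :: real set)"
  proof -
    have "(sphere (0::complex) 1 - {p}) homeomorphic {x::complex. 1 \<bullet> x = 0}"
      by (rule homeomorphic_punctured_sphere_hyperplane) (use p in auto)
    moreover have "{x::complex. 1 \<bullet> x = 0} homeomorphic (UNIV :: real set)"
      by (rule homeomorphic_affine_sets)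
        (use affine_hyperplane[of "1::complex" 0] aff_dim_hyperplane[of "1::complex" 0] in simp_all)
    ultimately show ?thesis using homeomorphic_trans by blast
  qed
  ultimately show ?thesis
    by (metis homeomorphic_space_trans top_of_set_homeomorphic_space_iff)
qed


lemma path_connected_frontier_unbounded_jordan_domain:
  assumes "unbounded_jordan_domain D"
  shows "path_connected (frontier D)"
  using homeomorphic_path_connectedness[OF frontier_unbounded_jordan_domain_homeomorphic_line[OF assms]]
  by simp

text \<open>Transported to the line, the part of the frontier in a disc becomes a compact set of reals, and it
  lies in a compact interval.\<close>

lemma frontier_exhausted_by_continua:
  assumes "unbounded_jordan_domain D"
  obtains M where "compact M" "connected M" "M \<subseteq> frontier D" "frontier D \<inter> cball 0 r \<subseteq> M"
proof -
  obtain f g where fg: "homeomorphism (frontier D) (UNIV :: real set) f g"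
    using frontier_unbounded_jordan_domain_homeomorphic_line[OF assms] by (auto simp: homeomorphic_def)
  have "compact (frontier D \<inter> cball 0 r)"
    by (simp add: closed_Int_compact)
  then have "compact (f ` (frontier D \<inter> cball 0 r))"
    using fg by (meson compact_continuous_image continuous_on_subset homeomorphism_cont1 inf_le1)
  then obtain b where b: "\<And>x. x \<in> f ` (frontier D \<inter> cball 0 r) \<Longrightarrow> norm x \<le> b"
    using compact_imp_bounded bounded_iff by metis
  have cont: "continuous_on {-b..b} g"
    using fg continuous_on_subset homeomorphism_cont2 by blast
  show thesis
  proof
    show "compact (g ` {-b..b})" using cont compact_continuous_image by blast
    show "connected (g ` {-b..b})" using cont connected_continuous_image connected_Icc by blast
    show "g ` {-b..b} \<subseteq> frontier D" using fg homeomorphism_image2 by blast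
    show "frontier D \<inter> cball 0 r \<subseteq> g ` {-b..b}"
    proof
      fix x assume x: "x \<in> frontier D \<inter> cball 0 r"
      then have "\<bar>f x\<bar> \<le> b" using b[of "f x"] by auto
      moreover have "g (f x) = x" using fg x by (auto simp: homeomorphism_def)
      ultimately show "x \<in> g ` {-b..b}" by (metis abs_le_iff atLeastAtMost_iff imageI minus_le_iff)
    qed
  qed
qed

text \<open>A Jordan domain has only one end at infinity. This is where the Jordan property is used in an
  essential way: for a general unbounded domain the part outside a large disc may split into
  infinitely many bounded fingers. Let \<open>M\<close> be a continuum in the frontier that contains all of the frontier
  in the disc of radius \<open>r\<close>. Two far away points of \<open>D\<close> are separated neither by the union \<open>S\<close> of \<open>M\<close>
  with the disc, since \<open>S\<close> is bounded, nor by the frontier. The two sets meet in the connected set \<open>M\<close>, so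
  by Janiszewski's theorem their union does not separate the points either.\<close>

lemma unbounded_jordan_domain_connected_at_infinity:
  assumes "unbounded_jordan_domain D"
  obtains C r' where "open C" "connected C" "C \<subseteq> D" "\<And>z. z \<in> C \<Longrightarrow> r < norm z"
    "\<And>z. z \<in> D \<Longrightarrow> r' < norm z \<Longrightarrow> z \<in> C" "r \<le> r'"
proof -
  have D: "open D" "connected D" using assms by (auto simp: unbounded_jordan_domain_def)
  obtain M where M: "compact M" "connected M" "M \<subseteq> frontier D" "frontier D \<inter> cball 0 r \<subseteq> M"
    using frontier_exhausted_by_continua[OF assms] by blast
  define S where "S = cball 0 r \<union> M"
  have "compact S" using M by (simp add: S_def compact_Un)
  then obtain s where s: "S \<subseteq> cball 0 s"
    using compact_imp_bounded[of S] by (auto simp: bounded_iff subset_iff)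
  define r' where "r' = max r s"
  have "connected (S \<inter> frontier D)"
  proof -
    have "S \<inter> frontier D = M" using M by (auto simp: S_def)
    then show ?thesis using M by simp
  qed
  have far: "connected_component (- S) a b" if "r' < norm a" "r' < norm b" for a b
  proof -
    have "connected (- cball (0::complex) r')"
      by (rule connected_complement_bounded_convex) auto
    moreover have "- cball (0::complex) r' \<subseteq> - S" using s by (auto simp: r'_def)
    ultimately show ?thesis
      unfolding connected_component_def using that by (metis ComplI mem_cball_0 not_le)
  qed
  obtain z0 where z0: "z0 \<in> D" "r' < norm z0"
    using unbounded_jordan_domain_unbounded[OF assms] by (meson bounded_iff not_le)
  define C where "C = connected_component_set (- (S \<union> frontier D)) z0"
  have oC: "open C"
    unfolding C_def using \<open>compact S\<close> by (intro open_connected_component) (simp add: compact_imp_closed open_Compl open_Int)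
  have cC: "connected C" by (simp add: C_def)
  have far2: "z \<in> C" if "z \<in> D" "r' < norm z" for z
  proof -
    have "connected_component (- frontier D) z0 z"
    proof -
      have "D \<subseteq> - frontier D" using D by (auto simp: frontier_def interior_open)
      then show ?thesis using D z0 that unfolding connected_component_def by blast
    qed
    then show ?thesis
      unfolding C_def using Janiszewski[OF \<open>compact S\<close> _ \<open>connected (S \<inter> frontier D)\<close>] far[OF z0(2) that(2)]
      by simp
  qed
  have disj: "C \<inter> frontier D = {}" "C \<inter> cball 0 r = {}"
    using connected_component_subset[of "- (S \<union> frontier D)" z0] by (auto simp: C_def S_def)
  have CD: "C \<subseteq> D"
  proof (rule ccontr)
    assume "\<not> C \<subseteq> D"
    then have "C \<inter> frontier D \<noteq> {}"
      using connected_Int_frontier[OF cC, of D] far2[OF z0] z0 by blast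
    then show False using disj(1) by simp
  qed
  have far_C: "r < norm z" if "z \<in> C" for z
    using that disj(2) by (meson disjoint_iff mem_cball_0 not_le)
  have "r \<le> r'" by (simp add: r'_def)
  show thesis by (rule that[OF oC cC CD far_C far2 \<open>r \<le> r'\<close>])
qed

section \<open>Winding numbers and crossings\<close>

text \<open>Two continuous logarithms of the same path differ by a constant, because their difference takes
  values in a discrete set. Hence any continuous logarithm computes the winding number.\<close>

lemma winding_number_of_continuous_log:
  assumes q: "path q" and p: "\<And>t. t \<in> {0..1} \<Longrightarrow> p t = e + exp (q t)"
  shows "2 * of_real pi * \<i> * winding_number p e = pathfinish q - pathstart q"
proof -
  have "continuous_on {0..1} (\<lambda>t. e + exp (q t))"
    using q unfolding path_def by (intro continuous_intros)
  then have "path p"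
    unfolding path_def using p by (metis (no_types, lifting) continuous_on_cong)
  moreover have "e \<notin> path_image p" using p by (auto simp: path_image_def)
  ultimately obtain r where r: "path r"
    "pathfinish r - pathstart r = 2 * of_real pi * \<i> * winding_number p e"
    "\<And>t. t \<in> {0..1} \<Longrightarrow> p t = e + exp (r t)"
    using winding_number_as_continuous_log by blast
  have "(\<lambda>t. (q t - r t) / (2 * of_real pi * \<i>)) constant_on {0..1}"
  proof (rule continuous_discrete_range_constant)
    show "connected {0..1::real}" by simp
    show "continuous_on {0..1} (\<lambda>t. (q t - r t) / (2 * of_real pi * \<i>))"
      using q r unfolding path_def by (intro continuous_intros) auto
    fix t :: real assume t: "t \<in> {0..1}"
    have int: "(q t - r t) / (2 * of_real pi * \<i>) \<in> \<int>" if t: "t \<in> {0..1}" for t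
    proof -
      have "exp (q t) = exp (r t)" using p[OF t] r(3)[OF t] by simp
      then obtain n :: int where "q t = r t + (of_int (2 * n) * pi) * \<i>"
        using exp_eq by auto
      then have "(q t - r t) / (2 * of_real pi * \<i>) = of_int n" by (simp add: field_simps)
      then show ?thesis by simp
    qed
    show "\<exists>e>0. \<forall>y. y \<in> {0..1} \<and> (q y - r y) / (2 * of_real pi * \<i>) \<noteq> (q t - r t) / (2 * of_real pi * \<i>)
          \<longrightarrow> e \<le> cmod ((q y - r y) / (2 * of_real pi * \<i>) - (q t - r t) / (2 * of_real pi * \<i>))"
    proof (intro exI[of _ 1] conjI allI impI)
      fix y assume y: "y \<in> {0..1} \<and> (q y - r y) / (2 * of_real pi * \<i>) \<noteq> (q t - r t) / (2 * of_real pi * \<i>)"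
      obtain m n :: int where "(q y - r y) / (2 * of_real pi * \<i>) = of_int m"
        "(q t - r t) / (2 * of_real pi * \<i>) = of_int n"
        using int[OF t] int[of y] y by (metis Ints_cases)
      moreover from this y have "m \<noteq> n" by auto
      then have "1 \<le> \<bar>m - n\<bar>" by linarith
      then have "1 \<le> \<bar>real_of_int (m - n)\<bar>" by linarith
      ultimately show "1 \<le> cmod ((q y - r y) / (2 * of_real pi * \<i>) - (q t - r t) / (2 * of_real pi * \<i>))"
        by (simp flip: of_int_diff)
    qed simp
  qed
  then obtain c where "\<And>t. t \<in> {0..1} \<Longrightarrow> (q t - r t) / (2 * of_real pi * \<i>) = c"
    by (auto simp: constant_on_def)
  from this[of 0] this[of 1] have "q 1 - r 1 = q 0 - r 0" by (simp add: field_simps)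
  then show ?thesis using r(2) by (simp add: pathfinish_def pathstart_def algebra_simps)
qed

lemma path_image_imp_mem: "t \<in> {0..1} \<Longrightarrow> p t \<in> path_image p"
  by (auto simp: path_image_def)

definition horizontal_ray :: "complex \<Rightarrow> complex set" where
  "horizontal_ray e = {z. Im z = Im e \<and> Re e \<le> Re z}"

text \<open>The path \<open>p\<close> goes from just above to just below a point of the ray without meeting the ray, so it must go
  around the tip \<open>e\<close>. Closed up by a vertical segment it has winding number \<open>1\<close> about \<open>e\<close>. A connected
  set that contains \<open>e\<close> and misses the loop lies in one component of its complement, so it cannot
  extend to infinity, where the winding number is \<open>0\<close>.\<close>

lemma no_path_around_tip_of_ray:
  fixes S :: "complex set"
  assumes S: "connected S" "\<not> bounded S" "e \<in> S"
    and p: "path p" "path_image p \<inter> (S \<union> horizontal_ray e) = {}"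
    and a: "pathstart p = a" "Re a = x" "Im a > Im e"
    and b: "pathfinish p = b" "Re b = x" "Im b < Im e"
    and x: "x > Re e" and seg: "closed_segment b a \<inter> S = {}"
  shows False
proof -
  define l where "l = p +++ linepath b a"
  have l: "path l" "pathfinish l = pathstart l" using p a b by (auto simp: l_def)
  have im: "path_image l = path_image p \<union> closed_segment b a"
    unfolding l_def using b by (simp add: path_image_join)
  then have disj: "S \<inter> path_image l = {}" using p seg by auto
  obtain B where B: "\<And>z. B \<le> norm z \<Longrightarrow> winding_number l z = 0"
    using winding_number_zero_at_infinity[OF l] by blast
  obtain z where z: "z \<in> S" "B \<le> norm z"
    using S(2) by (meson bounded_iff nle_le)
  have 0: "winding_number l e = 0"
    using winding_number_eq[OF l S(3) z(1) S(1) disj] B z by auto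
  have e: "e \<notin> path_image p" "e \<notin> path_image (linepath b a)"
    using disj S im by auto
  have slit: "- (z - e) \<notin> \<real>\<^sub>\<le>\<^sub>0" if "z \<in> path_image p" for z
  proof
    assume "- (z - e) \<in> \<real>\<^sub>\<le>\<^sub>0"
    then have "z \<in> horizontal_ray e"
      by (auto simp: complex_nonpos_Reals_iff horizontal_ray_def)
    then show False using that p by auto
  qed
  have w1: "2 * of_real pi * \<i> * winding_number p e = Ln (- (b - e)) - Ln (- (a - e))"
  proof -
    \<comment> \<open>a branch of the logarithm on the plane slit along the ray\<close>
    define q where "q = (\<lambda>t. Ln (- (p t - e)) + of_real pi * \<i>)"
    have "path q" unfolding path_def q_def
      using p(1) slit by (intro continuous_intros) (auto simp: path_def path_image_imp_mem)
    moreover have "p t = e + exp (q t)" if "t \<in> {0..1}" for t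
    proof -
      have "p t \<noteq> e" using e(1) path_image_imp_mem[OF that] by metis
      then show ?thesis by (simp add: q_def exp_add)
    qed
    ultimately show ?thesis
      using winding_number_of_continuous_log[of q p e] a b
      by (simp add: q_def pathfinish_def pathstart_def)
  qed
  have w2: "2 * of_real pi * \<i> * winding_number (linepath b a) e = Ln (a - e) - Ln (b - e)"
  proof -
    \<comment> \<open>the principal branch, since the segment lies to the right of the tip\<close>
    define q where "q = (\<lambda>t. Ln (linepath b a t - e))"
    have re: "Re (linepath b a t) = x" for t
      using a b by (simp add: linepath_def algebra_simps)
    have "linepath b a t - e \<notin> \<real>\<^sub>\<le>\<^sub>0" for t
      using re[of t] x by (auto simp: complex_nonpos_Reals_iff)
    then have "path q" unfolding path_def q_def
      by (intro continuous_intros) auto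
    moreover have "linepath b a t = e + exp (q t)" if "t \<in> {0..1}" for t
    proof -
      have "linepath b a t - e \<noteq> 0" using re[of t] x by auto
      then show ?thesis by (simp add: q_def)
    qed
    ultimately show ?thesis
      using winding_number_of_continuous_log[of q "linepath b a" e]
      by (simp add: q_def pathfinish_def pathstart_def linepath_def)
  qed
  have ane: "a \<noteq> e" "b \<noteq> e" using a b by auto
  have "Ln (- (b - e)) = Ln (b - e) + \<i> * pi"
    using Ln_minus[of "b - e"] ane a b x by (auto simp: complex_nonpos_Reals_iff)
  moreover have "Ln (- (a - e)) = Ln (a - e) - \<i> * pi"
    using Ln_minus[of "a - e"] ane a b x by (auto simp: complex_nonpos_Reals_iff)
  moreover have "2 * of_real pi * \<i> * winding_number l e
      = 2 * of_real pi * \<i> * winding_number p e + 2 * of_real pi * \<i> * winding_number (linepath b a) e"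
    unfolding l_def distrib_left[symmetric] using e p b by (subst winding_number_join) auto
  ultimately have "2 * of_real pi * \<i> * winding_number l e = 2 * of_real pi * \<i>"
    unfolding w1 w2 by algebra
  then show False using 0 by simp
qed

lemma periodic_set_frontier:
  assumes "periodic_set H"
  shows "periodic_set (frontier H)"
proof -
  have "(\<lambda>z. two_pi_i + z) ` H = H"
  proof (intro set_eqI iffI)
    fix z assume "z \<in> (\<lambda>z. two_pi_i + z) ` H"
    then show "z \<in> H" using assms by (auto simp: periodic_set_def add.commute)
  next
    fix z assume "z \<in> H"
    then have "(z - two_pi_i) + two_pi_i \<in> H" by simp
    then have "z - two_pi_i \<in> H" using assms unfolding periodic_set_def by blast
    then show "z \<in> (\<lambda>z. two_pi_i + z) ` H" by (intro image_eqI[of _ _ "z - two_pi_i"]) auto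
  qed
  then have "(\<lambda>z. two_pi_i + z) ` frontier H = frontier H"
    by (metis frontier_translation)
  then have "\<And>z. two_pi_i + z \<in> frontier H \<longleftrightarrow> z \<in> frontier H"
    by (smt (verit, best) add_left_cancel image_iff)
  then show ?thesis by (simp add: periodic_set_def add.commute)
qed

lemma periodic_set_of_nat:
  assumes "periodic_set S" shows "z + of_nat k * two_pi_i \<in> S \<longleftrightarrow> z \<in> S"
proof (induction k)
  case (Suc k)
  have "z + of_nat (Suc k) * two_pi_i = (z + of_nat k * two_pi_i) + two_pi_i"
    by (simp add: algebra_simps)
  then show ?case using Suc assms unfolding periodic_set_def by metis
qed simp

lemma periodic_set_of_int:
  assumes "periodic_set S" shows "z + of_int k * two_pi_i \<in> S \<longleftrightarrow> z \<in> S"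
proof (cases "k \<ge> 0")
  case True
  then show ?thesis using periodic_set_of_nat[OF assms, of z "nat k"] by simp
next
  case False
  then show ?thesis
    using periodic_set_of_nat[OF assms, of "z + of_int k * two_pi_i" "nat (- k)"] by simp
qed

text \<open>A path in the frontier from \<open>\<xi>\<close> to \<open>\<xi> + 2\<pi>\<i>\<close> becomes under \<open>exp\<close> a loop with winding number \<open>1\<close> about
  the origin. The connected set \<open>exp ` H\<close> misses this loop and contains points of arbitrarily large modulus,
  about which the winding number is \<open>0\<close>. So it cannot come close to the origin.\<close>

lemma periodic_domain_bounded_to_left:
  assumes H: "open H" "connected H" "periodic_set H" and R: "right_half_plane R \<subseteq> H"
    and fr: "path_connected (frontier H)" "frontier H \<noteq> {}"
  obtains m where "m > 0" "\<And>z. z \<in> H \<Longrightarrow> - m < Re z"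
proof -
  obtain \<xi> where \<xi>: "\<xi> \<in> frontier H" using fr by auto
  then have "\<xi> + two_pi_i \<in> frontier H"
    using periodic_set_frontier[OF H(3)] by (simp add: periodic_set_def)
  with \<xi> fr obtain g where g: "path g" "path_image g \<subseteq> frontier H" "pathstart g = \<xi>" "pathfinish g = \<xi> + two_pi_i"
    unfolding path_connected_def by blast
  define p where "p = exp \<circ> g"
  have p: "path p" unfolding p_def
    using g(1) by (intro path_continuous_image continuous_intros)
  have loop: "pathfinish p = pathstart p"
    using g by (simp add: p_def pathfinish_compose pathstart_compose exp_add)
  have w0: "winding_number p 0 = 1"
    using winding_number_of_continuous_log[OF g(1), of p 0] g by (simp add: p_def)
  obtain m where m: "m > 0" "\<And>z. z \<in> path_image g \<Longrightarrow> norm z \<le> m"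
    using bounded_path_image[OF g(1)] by (auto simp: bounded_pos)
  have pim: "exp (- m) \<le> norm z \<and> norm z \<le> exp m" if z: "z \<in> path_image p" for z
  proof -
    obtain w where "w \<in> path_image g" "z = exp w" using z unfolding p_def path_image_compose by blast
    moreover from this have "\<bar>Re w\<bar> \<le> m" using m(2)[of w] abs_Re_le_cmod[of w] by linarith
    ultimately show ?thesis by (auto simp: norm_exp_eq_Re)
  qed
  have disj: "exp ` H \<inter> path_image p = {}"
  proof (rule ccontr)
    assume "exp ` H \<inter> path_image p \<noteq> {}"
    then obtain w v where w: "w \<in> H" "v \<in> path_image g" "exp w = exp v"
      by (auto simp: p_def path_image_compose)
    then obtain n :: int where n: "w = v + (of_int (2 * n) * pi) * \<i>" using exp_eq by blast
    then have "w = v + of_int n * two_pi_i" by simp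
    then have "w \<in> frontier H"
      using w(2) g(2) periodic_set_of_int[OF periodic_set_frontier[OF H(3)], of v n] by auto
    then show False using w(1) H(1) by (simp add: frontier_def interior_open)
  qed
  have con: "connected (exp ` H)"
    using H(2) by (intro connected_continuous_image continuous_intros)
  define w1 :: complex where "w1 = of_real (max m R + 1)"
  have w1: "w1 \<in> H" "m < Re w1" using R by (auto simp: w1_def right_half_plane_def)
  have z1: "winding_number p (exp w1) = 0"
  proof (rule winding_number_zero_outside[OF p convex_cball loop])
    show "exp w1 \<notin> cball 0 (exp m)" using w1 by (simp add: norm_exp_eq_Re)
    show "path_image p \<subseteq> cball 0 (exp m)" using pim by auto
  qed
  have "- m \<le> Re w" if w: "w \<in> H" for w
  proof (rule ccontr)
    assume "\<not> - m \<le> Re w"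
    then have in_ball: "exp w \<in> ball 0 (exp (- m))" by (simp add: norm_exp_eq_Re)
    have "winding_number p (exp w) = winding_number p 0"
      by (rule winding_number_eq[OF p loop in_ball]) (use pim in \<open>force+\<close>)
    moreover have "winding_number p (exp w) = winding_number p (exp w1)"
      by (rule winding_number_eq[OF p loop _ _ con disj]) (use w w1 in auto)
    ultimately show False using w0 z1 by simp
  qed
  then show thesis using that[of "m + 1"] m by force
qed

section \<open>A lower bound next to a curve to infinity\<close>

text \<open>A crossing argument that keeps the frontier of \<open>H\<close> away from the right-hand side of a curve. The
  curve \<open>q\<close>, continued by the unbounded set \<open>Y\<close>, rises to the left of the point \<open>y + \<i>t\<close>, and \<open>\<sigma>\<close>
  links its lower end inside \<open>H\<close> to a horizontal ray in \<open>H\<close>. If the component of \<open>y + \<i>t\<close> in the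
  horizontal half-strip minus \<open>q\<close> contained a frontier point, one could continue from there
  inside the periodic frontier to a point far below, and so walk around the tip of the ray without
  meeting \<open>\<sigma>\<close>, \<open>q\<close>, \<open>Y\<close> or the ray.\<close>

lemma component_below_path_subset_domain:
  assumes H: "open H" "periodic_set H" "path_connected (frontier H)" "right_half_plane R \<subseteq> H"
    and \<sigma>: "path \<sigma>" "path_image \<sigma> \<subseteq> H" "\<And>z. z \<in> path_image \<sigma> \<Longrightarrow> \<bar>Im z\<bar> \<le> s1"
    and e: "pathstart \<sigma> = e" "Im e = 0" "y' \<le> Re e"
    and q: "path q" "path_image q \<subseteq> H" "\<And>z. z \<in> path_image q \<Longrightarrow> Re z < y \<and> 0 < Im z"
    and Y: "connected Y" "\<not> bounded Y" "Y \<subseteq> H" "\<And>z. z \<in> Y \<Longrightarrow> Re z < y \<and> s2 < Im z"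
    and join: "pathfinish \<sigma> = pathstart q" "pathfinish q \<in> Y"
    and y: "R < y" "y < y'" and t: "0 \<le> s1" "s1 < t" "t < s2"
  shows "connected_component_set ({z. Re z < y' \<and> s1 < Im z \<and> Im z < s2} - path_image q) (Complex y t) \<subseteq> H"
    (is "?U \<subseteq> H")
proof (rule ccontr)
  assume neg: "\<not> ?U \<subseteq> H"
  define \<Omega> where "\<Omega> = {z. Re z < y' \<and> s1 < Im z \<and> Im z < s2} - path_image q"
  define w0 where "w0 = Complex y t"
  have "\<Omega> = {z. Re z < y'} \<inter> {z. s1 < Im z} \<inter> {z. Im z < s2} \<inter> - path_image q"
    by (auto simp: \<Omega>_def)
  moreover have "open (- path_image q)" using q(1) closed_path_image by blast
  ultimately have "open \<Omega>"
    by (simp add: open_Int open_halfspace_Re_lt open_halfspace_Im_gt open_halfspace_Im_lt)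
  have w0: "w0 \<in> \<Omega>" using q(3)[of w0] y t by (auto simp: \<Omega>_def w0_def)
  have w0H: "w0 \<in> H" using H(4) y by (auto simp: right_half_plane_def w0_def)
  obtain \<xi> where \<xi>: "\<xi> \<in> connected_component_set \<Omega> w0" "\<xi> \<in> frontier H"
  proof -
    have "w0 \<in> connected_component_set \<Omega> w0" using w0 by simp
    then have "connected_component_set \<Omega> w0 \<inter> H \<noteq> {}" using w0H by blast
    moreover have "connected_component_set \<Omega> w0 - H \<noteq> {}"
      using neg unfolding \<Omega>_def w0_def by blast
    ultimately have "connected_component_set \<Omega> w0 \<inter> frontier H \<noteq> {}"
      by (intro connected_Int_frontier) auto
    then show thesis using that by blast
  qed
  have \<xi>\<Omega>: "\<xi> \<in> \<Omega>" using \<xi>(1) connected_component_subset by blast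
  have "path_component \<Omega> w0 \<xi>"
    using \<xi>(1) \<open>open \<Omega>\<close> by (simp add: open_path_connected_component)
  then obtain P where P: "path P" "path_image P \<subseteq> \<Omega>" "pathstart P = w0" "pathfinish P = \<xi>"
    by (auto simp: path_component_def)
  obtain N :: nat where N: "Im \<xi> + s1 < of_nat N * (2 * pi)"
    using reals_Archimedean3[of "2 * pi"] by (metis mult_pos_pos pi_gt_zero zero_less_numeral)
  \<comment> \<open>a translate of the frontier point, below all of \<open>\<sigma>\<close>\<close>
  define \<xi>' where "\<xi>' = \<xi> + of_int (- int N) * two_pi_i"
  have \<xi>': "Re \<xi>' = Re \<xi>" "Im \<xi>' < - s1" using N by (auto simp: \<xi>'_def mult.commute)
  have "\<xi>' \<in> frontier H"
    unfolding \<xi>'_def periodic_set_of_int[OF periodic_set_frontier[OF H(2)]] by (rule \<xi>)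
  with H(3) \<xi>(2) obtain D where D: "path D" "path_image D \<subseteq> frontier H" "pathstart D = \<xi>" "pathfinish D = \<xi>'"
    unfolding path_connected_def by blast
  obtain c where c: "\<And>z. z \<in> path_image \<sigma> \<Longrightarrow> norm z \<le> c"
    using bounded_path_image[OF \<sigma>(1)] by (auto simp: bounded_iff)
  define x where "x = max (Re e) c + 1"
  have x: "Re e < x" "c < x" by (auto simp: x_def)
  define a where "a = Complex x t"
  define b where "b = Complex x (Im \<xi>')"
  define S where "S = path_image \<sigma> \<union> path_image q \<union> Y"
  have "connected (path_image \<sigma> \<union> path_image q)"
    using \<sigma>(1) q(1) join(1) by (intro connected_Un connected_path_image) (metis IntI empty_iff pathfinish_in_path_image pathstart_in_path_image)+
  then have conS: "connected S" unfolding S_def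
    by (rule connected_Un[OF _ Y(1)]) (use join(2) in \<open>auto intro: pathfinish_in_path_image\<close>)
  have unbS: "\<not> bounded S" using Y(2) by (auto simp: S_def)
  have eS: "e \<in> S" using e(1) by (auto simp: S_def)
  have SH: "S \<subseteq> H" using \<sigma>(2) q(2) Y(3) by (auto simp: S_def)
  have rayH: "horizontal_ray e \<subseteq> H"
    using H(4) y e by (force simp: horizontal_ray_def right_half_plane_def)
  have frH: "frontier H \<inter> H = {}" using H(1) by (auto simp: frontier_def interior_open)
  \<comment> \<open>from far right to \<open>w0\<close>, to the frontier, down inside the frontier, and back to far right\<close>
  define p where "p = linepath a w0 +++ P +++ D +++ linepath \<xi>' b"
  have p: "path p" "pathstart p = a" "pathfinish p = b" using P D by (auto simp: p_def)
  have imp: "path_image p = closed_segment a w0 \<union> path_image P \<union> path_image D \<union> closed_segment \<xi>' b"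
    using P D by (auto simp: p_def path_image_join)
  have Sprop: "(\<bar>Im z\<bar> \<le> s1 \<and> Re z < x) \<or> (Re z < y \<and> 0 < Im z)" if "z \<in> S" for z
  proof -
    have "Re z < x" if "z \<in> path_image \<sigma>"
      using c[OF that] x(2) complex_Re_le_cmod[of z] by linarith
    then show ?thesis using that \<sigma>(3) q(3) Y(4) t unfolding S_def by force
  qed
  have seg: "closed_segment b a \<inter> S = {}"
  proof -
    have "Re z = x" if "z \<in> closed_segment b a" for z
      using that unfolding a_def b_def by (auto simp: closed_segment_same_Re)
    then show ?thesis using Sprop x y e by fastforce
  qed
  have 1: "closed_segment a w0 \<inter> (S \<union> horizontal_ray e) = {}"
  proof -
    have "Im z = t \<and> y \<le> Re z" if "z \<in> closed_segment a w0" for z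
      using that y x e unfolding a_def w0_def
      by (auto simp: closed_segment_same_Im closed_segment_eq_real_ivl split: if_splits)
    then show ?thesis using Sprop t e by (fastforce simp: horizontal_ray_def)
  qed
  have 2: "path_image P \<inter> (S \<union> horizontal_ray e) = {}"
    using P(2) \<sigma>(3) Y(4) t e unfolding \<Omega>_def S_def horizontal_ray_def by fastforce
  have 3: "path_image D \<inter> (S \<union> horizontal_ray e) = {}"
    using D(2) SH rayH frH by blast
  have 4: "closed_segment \<xi>' b \<inter> (S \<union> horizontal_ray e) = {}"
  proof -
    have "z \<notin> S \<union> horizontal_ray e" if "z \<in> closed_segment \<xi>' b" for z
    proof -
      have "Im z = Im \<xi>'" using that unfolding b_def by (auto simp: closed_segment_same_Im)
      then show ?thesis using Sprop[of z] \<xi>' t e by (auto simp: horizontal_ray_def)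
    qed
    then show ?thesis by blast
  qed
  have disj: "path_image p \<inter> (S \<union> horizontal_ray e) = {}"
    unfolding imp using 1 2 3 4 by blast
  show False
    by (rule no_path_around_tip_of_ray[OF conS unbS eS p(1) disj p(2) _ _ p(3) _ _ x(1) seg])
      (use e t \<xi>' in \<open>auto simp: a_def b_def\<close>)
qed

text \<open>A two-constants estimate. In a component of a horizontal half-strip to the right of the curve \<open>q\<close>, the
  function \<open>Re f\<close> is at least \<open>-\<mu>\<close>, and at least \<open>\<beta> - \<mu>\<close> on \<open>q\<close>. The other boundary points
  of the component lie on the right, lower and upper side of the half-strip and inside \<open>H\<close>, by the
  preceding lemma. An explicit harmonic minorant of the harmonic measure of \<open>q\<close> shows that a definite
  proportion of \<open>\<beta>\<close> is felt at a point half way up on the line \<open>Re w = y\<close>.\<close>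

lemma lower_bound_beside_path:
  assumes H: "open H" "periodic_set H" "path_connected (frontier H)" "right_half_plane R \<subseteq> H"
      "\<And>z. z \<in> H \<Longrightarrow> - m < Re z"
    and \<sigma>: "path \<sigma>" "path_image \<sigma> \<subseteq> H" "\<And>z. z \<in> path_image \<sigma> \<Longrightarrow> \<bar>Im z\<bar> \<le> s1"
    and e: "pathstart \<sigma> = e" "Im e = 0" "y + 2 \<le> Re e"
    and q: "path q" "path_image q \<subseteq> H" "\<And>z. z \<in> path_image q \<Longrightarrow> Re z < y \<and> 0 < Im z"
    and Y: "connected Y" "\<not> bounded Y" "Y \<subseteq> H" "\<And>z. z \<in> Y \<Longrightarrow> Re z < y \<and> s2 < Im z"
    and join: "pathfinish \<sigma> = pathstart q" "pathfinish q \<in> Y"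
    and y: "R < y" and t: "0 \<le> s1" "s1 < t1" "t1 < t2" "t2 < s2"
    and f: "f holomorphic_on H" "\<And>z. z \<in> H \<Longrightarrow> - \<mu> \<le> Re (f z)"
      "\<And>z. z \<in> path_image q \<Longrightarrow> \<beta> - \<mu> \<le> Re (f z)" and \<beta>: "0 \<le> \<beta>"
    and \<kappa>: "\<kappa> = 1 / (y + 1 + m)"
  shows "\<beta> * (\<kappa> - 4 * exp (- \<kappa> * ((t2 - t1) / 2))) - \<mu> \<le> Re (f (Complex y ((t1 + t2) / 2)))"
proof -
  define w0 where "w0 = Complex y ((t1 + t2) / 2)"
  \<comment> \<open>The component is formed in a larger half-strip than \<open>B\<close>. Its limit points in the closure of \<open>B\<close> then belong to it or to \<open>q\<close>.\<close>
  define \<Omega> where "\<Omega> = {z. Re z < y + 2 \<and> s1 < Im z \<and> Im z < s2} - path_image q"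
  define U where "U = connected_component_set \<Omega> w0"
  define B where "B = {z. Re z < y + 1} \<inter> {z. t1 < Im z} \<inter> {z. Im z < t2}"
  have "w0 \<in> H" using H(4) y by (auto simp: right_half_plane_def w0_def)
  then have ym: "0 < y + m" using H(5)[of w0] by (simp add: w0_def)
  then have \<kappa>0: "\<kappa> > 0" using \<kappa> by simp
  have "open (- path_image q)" using q(1) closed_path_image by blast
  moreover have "\<Omega> = {z. Re z < y + 2} \<inter> {z. s1 < Im z} \<inter> {z. Im z < s2} \<inter> - path_image q"
    by (auto simp: \<Omega>_def)
  ultimately have "open \<Omega>"
    by (simp add: open_Int open_halfspace_Re_lt open_halfspace_Im_gt open_halfspace_Im_lt)
  then have "open U" by (simp add: U_def open_connected_component)
  have "open B" unfolding B_def
    by (simp add: open_Int open_halfspace_Re_lt open_halfspace_Im_gt open_halfspace_Im_lt)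
  have w0\<Omega>: "w0 \<in> \<Omega>" using q(3)[of w0] t by (auto simp: \<Omega>_def w0_def)
  have UH: "U \<subseteq> H" unfolding U_def \<Omega>_def w0_def
    by (rule component_below_path_subset_domain[OF H(1-4) \<sigma> e q Y join y]) (use t in auto)
  have closB: "closure B \<subseteq> {z. Re z \<le> y + 1 \<and> t1 \<le> Im z \<and> Im z \<le> t2}"
  proof (rule closure_minimal)
    have "closed ({z. Re z \<le> y + 1} \<inter> {z. t1 \<le> Im z} \<inter> {z. Im z \<le> t2})"
      by (intro closed_Int closed_halfspace_Re_le closed_halfspace_Im_ge closed_halfspace_Im_le)
    then show "closed {z. Re z \<le> y + 1 \<and> t1 \<le> Im z \<and> Im z \<le> t2}"
      by (simp add: Collect_conj_eq Int_assoc)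
  qed (auto simp: B_def)
  have clos: "closure (U \<inter> B) \<subseteq> (U \<inter> {z. Re z \<le> y + 1 \<and> t1 \<le> Im z \<and> Im z \<le> t2}) \<union> path_image q"
  proof
    fix z assume z: "z \<in> closure (U \<inter> B)"
    then have zU: "z \<in> closure U" and zB: "z \<in> closure B" using closure_mono inf_le1 inf_le2 by blast+
    show "z \<in> (U \<inter> {z. Re z \<le> y + 1 \<and> t1 \<le> Im z \<and> Im z \<le> t2}) \<union> path_image q"
    proof (cases "z \<in> path_image q")
      case False
      have "z \<in> \<Omega>" using False zB closB t by (force simp: \<Omega>_def)
      moreover have "connected (insert z U)"
        by (rule connected_intermediate_closure[of U]) (use zU closure_subset[of U] in \<open>simp_all add: U_def subset_insertI\<close>)
      moreover have "w0 \<in> U" using w0\<Omega> by (simp add: U_def)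
      moreover have "U \<subseteq> \<Omega>" unfolding U_def by (rule connected_component_subset)
      ultimately have "insert z U \<subseteq> U"
        unfolding U_def by (intro connected_component_maximal) auto
      then have "z \<in> U" by simp
      then show ?thesis using zB closB by blast
    qed simp
  qed
  have frB: "z \<in> path_image q \<or> (z \<in> U \<and> t1 \<le> Im z \<and> Im z \<le> t2 \<and> (Re z = y + 1 \<or> (Re z \<le> y + 1 \<and> (Im z = t1 \<or> Im z = t2))))"
    if "z \<in> frontier (U \<inter> B)" for z
  proof -
    have "z \<notin> U \<inter> B" using that \<open>open U\<close> \<open>open B\<close> by (simp add: frontier_def interior_open open_Int)
    moreover have "z \<in> closure (U \<inter> B)" using that by (simp add: frontier_def)
    ultimately show ?thesis using clos by (force simp: B_def)
  qed
  have closH: "closure (U \<inter> B) \<subseteq> H" using clos UH q(2) by blast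
  \<comment> \<open>The real part of \<open>\<Psi>\<close> is a harmonic function that is at most \<open>1\<close> on the curve, and at most \<open>0\<close> on the right
    side, where the linear term vanishes, and on the lower and upper side, where one of the
    exponential terms outweighs it.\<close>
  define \<Psi> where "\<Psi> = (\<lambda>w. of_real \<kappa> * (of_real (y + 1) - w)
      - 2 * exp (\<i> * of_real \<kappa> * (w - Complex (y + 1) t1)) - 2 * exp (- (\<i> * of_real \<kappa> * (w - Complex (y + 1) t2))))"
  have Re\<Psi>: "Re (\<Psi> w) = \<kappa> * (y + 1 - Re w) - 2 * (exp (- \<kappa> * (Im w - t1)) * cos (\<kappa> * (Re w - (y + 1))))
     - 2 * (exp (\<kappa> * (Im w - t2)) * cos (\<kappa> * (Re w - (y + 1))))" for w
  proof -
    have "cos (- (\<kappa> * (Re w - (y + 1)))) = cos (\<kappa> * (Re w - (y + 1)))" by (rule cos_minus)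
    then show ?thesis by (simp add: \<Psi>_def Re_exp)
  qed
  have cos_ge: "1 / 2 \<le> cos (\<kappa> * (Re w - (y + 1)))" if "w \<in> H" "Re w \<le> y + 1" for w
  proof -
    have "y + 1 - Re w < y + 1 + m" using H(5)[OF that(1)] by simp
    then have "\<kappa> * (y + 1 - Re w) \<le> 1" unfolding \<kappa> using ym by (simp add: field_simps)
    moreover have "0 \<le> \<kappa> * (y + 1 - Re w)" using \<kappa>0 that(2) by simp
    ultimately have "cos 1 \<le> cos (\<kappa> * (y + 1 - Re w))"
      using pi_gt3 by (intro cos_monotone_0_pi_le) auto
    moreover have "cos (pi / 3) \<le> cos (1::real)" using pi_gt3 by (intro cos_monotone_0_pi_le) auto
    ultimately have "1 / 2 \<le> cos (\<kappa> * (y + 1 - Re w))" by (simp add: cos_60)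
    moreover have "\<kappa> * (Re w - (y + 1)) = - (\<kappa> * (y + 1 - Re w))" by (simp add: algebra_simps)
    ultimately show ?thesis by (simp only: cos_minus)
  qed
  have le1: "\<kappa> * (y + 1 - Re w) \<le> 1" if "w \<in> H" for w
  proof -
    have "y + 1 - Re w < y + 1 + m" using H(5)[OF that(1)] by simp
    then show ?thesis unfolding \<kappa> using ym by (simp add: field_simps)
  qed
  define h where "h = (\<lambda>w. exp (- f w + of_real \<beta> * \<Psi> w))"
  have "cmod (h w0) \<le> exp \<mu>"
  proof (rule maximum_modulus_frontier[where f = h and S = "U \<inter> B" and \<xi> = w0])
    have holH: "h holomorphic_on H" unfolding h_def \<Psi>_def
      using f(1) by (intro holomorphic_intros)
    show "h holomorphic_on interior (U \<inter> B)"
      using holH by (rule holomorphic_on_subset) (use interior_subset UH in blast)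
    show "continuous_on (closure (U \<inter> B)) h"
      using holH closH continuous_on_subset holomorphic_on_imp_continuous_on by blast
    show "bounded (U \<inter> B)"
    proof (rule bounded_subset)
      show "bounded (cbox (Complex (- m) t1) (Complex (y + 1) t2))" by (rule bounded_cbox)
      show "U \<inter> B \<subseteq> cbox (Complex (- m) t1) (Complex (y + 1) t2)"
        using UH H(5) by (force simp: B_def in_cbox_complex_iff)
    qed
    show "w0 \<in> U \<inter> B"
      using w0\<Omega> t by (simp add: U_def B_def) (simp add: w0_def field_simps)
    fix w assume w: "w \<in> frontier (U \<inter> B)"
    then have wH: "w \<in> H" using closH by (auto simp: frontier_def)
    have wre: "Re w \<le> y + 1" using frB[OF w] q(3)[of w] by auto
    have pos: "0 \<le> exp (- \<kappa> * (Im w - t1)) * cos (\<kappa> * (Re w - (y + 1)))"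
      "0 \<le> exp (\<kappa> * (Im w - t2)) * cos (\<kappa> * (Re w - (y + 1)))"
      using cos_ge[OF wH wre] by auto
    have "- Re (f w) + \<beta> * Re (\<Psi> w) \<le> \<mu>"
    proof (cases "w \<in> path_image q")
      case True
      have "Re (\<Psi> w) \<le> 1" using Re\<Psi>[of w] le1[OF wH] pos by linarith
      then have "\<beta> * Re (\<Psi> w) \<le> \<beta>" using \<beta> by (simp add: mult_left_le)
      then show ?thesis using f(3)[OF True] by linarith
    next
      case False
      with frB[OF w] consider "Re w = y + 1" | "Im w = t1" | "Im w = t2" by blast
      then have "Re (\<Psi> w) \<le> 0"
      proof cases
        case 1
        then have "\<kappa> * (y + 1 - Re w) = 0" by simp
        then show ?thesis using Re\<Psi>[of w] pos by linarith
      next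
        case 2
        then have "exp (- \<kappa> * (Im w - t1)) = 1" by simp
        then show ?thesis using Re\<Psi>[of w] le1[OF wH] pos cos_ge[OF wH wre]
          by (simp only: mult_1_left)
      next
        case 3
        then have "exp (\<kappa> * (Im w - t2)) = 1" by simp
        then show ?thesis using Re\<Psi>[of w] le1[OF wH] pos cos_ge[OF wH wre]
          by (simp only: mult_1_left)
      qed
      then have "\<beta> * Re (\<Psi> w) \<le> 0" using \<beta> by (simp add: mult_nonneg_nonpos)
      then show ?thesis using f(2)[OF wH] by linarith
    qed
    then show "cmod (h w) \<le> exp \<mu>" by (simp add: h_def norm_exp_eq_Re)
  qed
  then have fin: "- Re (f w0) + \<beta> * Re (\<Psi> w0) \<le> \<mu>" by (simp add: h_def norm_exp_eq_Re)
  have half: "Im w0 - t1 = (t2 - t1) / 2" "Im w0 - t2 = - ((t2 - t1) / 2)"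
    by (auto simp: w0_def field_simps)
  have "exp (- \<kappa> * ((t2 - t1) / 2)) * cos (\<kappa> * (Re w0 - (y + 1))) \<le> exp (- \<kappa> * ((t2 - t1) / 2))"
    by simp
  then have "\<kappa> - 4 * exp (- \<kappa> * ((t2 - t1) / 2)) \<le> Re (\<Psi> w0)"
    unfolding Re\<Psi> half by (simp add: w0_def)
  then have "\<beta> * (\<kappa> - 4 * exp (- \<kappa> * ((t2 - t1) / 2))) \<le> \<beta> * Re (\<Psi> w0)"
    using \<beta> by (rule mult_left_mono)
  then show ?thesis using fin unfolding w0_def by linarith
qed

section \<open>Growth of functions on domains containing a half-plane\<close>

text \<open>Integration of the derivative bound \<open>C / (Re w - R)\<close>.\<close>

lemma log_growth_along_horizontal:
  assumes f: "f holomorphic_on right_half_plane R"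
    and C: "\<And>w. R < Re w \<Longrightarrow> cmod (deriv f w) * (Re w - R) \<le> C"
    and y: "R < y" "y \<le> Re w"
  shows "Re (f w) \<le> Re (f (Complex y (Im w))) + C * (ln (Re w - R) - ln (y - R))"
proof -
  define \<phi> where "\<phi> = (\<lambda>s. Re (f (Complex s (Im w))) - C * ln (s - R))"
  have op: "open (right_half_plane R)"
    unfolding right_half_plane_def by (simp add: open_halfspace_Re_gt)
  have "\<phi> (Re w) \<le> \<phi> y"
  proof (rule DERIV_nonpos_imp_nonincreasing[OF y(2)])
    fix s assume s: "y \<le> s" "s \<le> Re w"
    define z where "z = Complex s (Im w)"
    have z: "z \<in> right_half_plane R" "Re z = s" using s y by (auto simp: z_def right_half_plane_def)
    have lift: "((\<lambda>s. of_real s + \<i> * of_real (Im w)) has_vector_derivative 1) (at s)"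
      by (auto intro!: derivative_eq_intros)
    have "(f has_field_derivative deriv f z) (at z)"
      using holomorphic_derivI[OF f op z(1)] .
    then have "((\<lambda>s. f (of_real s + \<i> * of_real (Im w))) has_vector_derivative (1 * deriv f z)) (at s)"
      using field_vector_diff_chain_at[OF lift, of f "deriv f z"]
      by (simp add: z_def Complex_eq o_def)
    then have "((\<lambda>s. Re (f (of_real s + \<i> * of_real (Im w)))) has_vector_derivative Re (deriv f z)) (at s)"
      using bounded_linear.has_vector_derivative[OF bounded_linear_Re] by fastforce
    then have 1: "((\<lambda>s. Re (f (Complex s (Im w)))) has_real_derivative Re (deriv f z)) (at s)"
      by (simp add: has_real_derivative_iff_has_vector_derivative Complex_eq)
    have "((\<lambda>s. C * ln (s - R)) has_real_derivative C * (1 / (s - R))) (at s)"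
      using s y by (auto intro!: derivative_eq_intros)
    from DERIV_diff[OF 1 this]
    have "(\<phi> has_real_derivative (Re (deriv f z) - C * (1 / (s - R)))) (at s)"
      unfolding \<phi>_def .
    moreover have "Re (deriv f z) * (s - R) \<le> C"
      using C[of z] z complex_Re_le_cmod[of "deriv f z"] s y
      by (smt (verit, best) mult_right_mono)
    then have "Re (deriv f z) - C * (1 / (s - R)) \<le> 0"
      using s y by (simp add: field_simps)
    ultimately show "\<exists>d. (\<phi> has_real_derivative d) (at s) \<and> d \<le> 0" by blast
  qed
  then show ?thesis by (simp add: \<phi>_def algebra_simps)
qed

text \<open>The growth is at most logarithmic to the right of the line, so subtracting a small multiple of a
  square root makes the maximum principle applicable on large half-discs.\<close>

lemma phragmen_lindelof_right_half_plane:
  assumes f: "f holomorphic_on right_half_plane R"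
    and C: "\<And>w. R < Re w \<Longrightarrow> cmod (deriv f w) * (Re w - R) \<le> C"
    and y: "R < y" and bd: "\<And>w. Re w = y \<Longrightarrow> Re (f w) \<le> b"
    and w: "y \<le> Re w"
  shows "Re (f w) \<le> b"
proof -
  \<comment> \<open>the square root is shifted by \<open>1\<close> so that its argument stays away from the negative axis\<close>
  define d where "d = y - R"
  have d: "d > 0" using y by (simp add: d_def)
  have C0: "0 \<le> C" using C[of "Complex y 0"] y by (smt (verit) complex.sel(1) mult_nonneg_nonneg norm_ge_zero)
  have csqrt_ge: "sqrt (cmod u / 2) \<le> Re (csqrt u)" if "0 \<le> Re u" for u
    using that by simp
  have eps: "Re (f w) \<le> b + \<epsilon> * Re (csqrt (w - of_real y + 1))" if \<epsilon>: "\<epsilon> > 0" for \<epsilon>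
  proof -
    have "\<forall>\<^sub>F \<rho> in at_top. C * (ln (\<rho> + d) - ln d) \<le> \<epsilon> * sqrt (\<rho> / 2)"
      using \<epsilon> d by real_asymp
    moreover have "\<forall>\<^sub>F \<rho> in at_top. cmod (w - of_real y) < \<rho>" by (rule eventually_gt_at_top)
    ultimately obtain \<rho> where \<rho>: "C * (ln (\<rho> + d) - ln d) \<le> \<epsilon> * sqrt (\<rho> / 2)" "cmod (w - of_real y) < \<rho>"
      using eventually_happens'[OF trivial_limit_at_top_linorder eventually_conj] by blast
    define S where "S = {z. y \<le> Re z} \<inter> cball (of_real y) \<rho>"
    have Re_in: "y \<le> Re z \<Longrightarrow> z \<in> right_half_plane R" for z using y by (simp add: right_half_plane_def)
    have clS: "closed S" unfolding S_def by (intro closed_Int closed_halfspace_Re_ge closed_cball)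
    define g where "g = (\<lambda>z. exp (f z - of_real \<epsilon> * csqrt (z - of_real y + 1)))"
    have norm_g: "cmod (g z) = exp (Re (f z) - \<epsilon> * Re (csqrt (z - of_real y + 1)))" for z
      unfolding g_def norm_exp_eq_Re minus_complex.sel Re_complex_of_real times_complex.sel by simp
    have holg: "g holomorphic_on {z. y - 1 < Re z} \<inter> right_half_plane R"
      unfolding g_def using f
      by (intro holomorphic_intros) (auto intro: holomorphic_on_subset simp: complex_nonpos_Reals_iff)
    have Ssub: "S \<subseteq> {z. y - 1 < Re z} \<inter> right_half_plane R" using Re_in by (auto simp: S_def)
    have "cmod (g w) \<le> exp b"
    proof (rule maximum_modulus_frontier[where f = g and S = S and \<xi> = w])
      show "g holomorphic_on interior S"
        using holg Ssub interior_subset holomorphic_on_subset by (meson subset_trans)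
      show "continuous_on (closure S) g"
        using holg Ssub clS by (metis closure_closed continuous_on_subset holomorphic_on_imp_continuous_on)
      show "bounded S" unfolding S_def by (simp add: bounded_Int)
      show "w \<in> S" using w \<rho>(2) by (simp add: S_def dist_norm norm_minus_commute less_imp_le)
      fix z assume z: "z \<in> frontier S"
      then have zS: "z \<in> S" using clS frontier_subset_closed by blast
      have int: "{z. y < Re z} \<inter> ball (of_real y) \<rho> \<subseteq> interior S"
        by (rule interior_maximal) (auto simp: S_def open_Int open_halfspace_Re_gt)
      have "z \<notin> {z. y < Re z} \<inter> ball (of_real y) \<rho>" using z int by (auto simp: frontier_def)
      with zS consider "Re z = y" | "cmod (z - of_real y) = \<rho>"
        by (force simp: S_def dist_norm norm_minus_commute)
      then have "Re (f z) - \<epsilon> * Re (csqrt (z - of_real y + 1)) \<le> b"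
      proof cases
        case 1
        have "0 \<le> Re (csqrt (z - of_real y + 1))" by (rule Re_csqrt)
        then have "0 \<le> \<epsilon> * Re (csqrt (z - of_real y + 1))" using \<epsilon> by simp
        then show ?thesis using bd[OF 1] by linarith
      next
        case 2
        have yz: "y \<le> Re z" using zS by (simp add: S_def)
        have "Re (z - of_real y) \<le> \<rho>" using 2 complex_Re_le_cmod[of "z - of_real y"] by simp
        then have "Re z - R \<le> \<rho> + d" by (simp add: d_def)
        then have "ln (Re z - R) \<le> ln (\<rho> + d)" using yz y by simp
        then have "C * (ln (Re z - R) - ln d) \<le> C * (ln (\<rho> + d) - ln d)"
          using C0 by (intro mult_left_mono) auto
        moreover have "Re (f z) \<le> b + C * (ln (Re z - R) - ln d)"
          using log_growth_along_horizontal[OF f C y yz] bd[of "Complex y (Im z)"] by (simp add: d_def)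
        moreover have "\<epsilon> * sqrt (\<rho> / 2) \<le> \<epsilon> * Re (csqrt (z - of_real y + 1))"
        proof -
          have "(cmod (z - of_real y))\<^sup>2 \<le> (cmod (z - of_real y + 1))\<^sup>2"
            unfolding cmod_power2 using yz by (simp add: power2_eq_square algebra_simps)
          then have "\<rho> \<le> cmod (z - of_real y + 1)" using 2 by (simp add: power2_le_iff_abs_le)
          then have "sqrt (\<rho> / 2) \<le> sqrt (cmod (z - of_real y + 1) / 2)" by simp
          also have "\<dots> \<le> Re (csqrt (z - of_real y + 1))" using yz by (intro csqrt_ge) simp
          finally show ?thesis using \<epsilon> by simp
        qed
        ultimately show ?thesis using \<rho>(1) by linarith
      qed
      then show "cmod (g z) \<le> exp b" by (simp add: norm_g)
    qed
    then show ?thesis by (simp add: norm_g)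
  qed
  have "Re (f w) \<le> b + e" if "e > 0" for e
  proof -
    define s where "s = Re (csqrt (w - of_real y + 1))"
    have "s \<ge> 0" unfolding s_def by (rule Re_csqrt)
    have "e / (s + 1) * s \<le> e" using \<open>s \<ge> 0\<close> that by (simp add: field_simps)
    then show ?thesis using eps[of "e / (s + 1)"] \<open>s \<ge> 0\<close> that unfolding s_def[symmetric] by simp
  qed
  then show ?thesis by (rule field_le_epsilon)
qed

text \<open>The set \<open>X\<close> reaches infinity in the upper half-plane to the left of the line \<open>Re w = y\<close>. A long
  enough piece of it, chosen as a path \<open>q\<close> in \<open>X\<close>, makes the loss at the lower and upper side of the
  half-strip in \<open>lower_bound_beside_path\<close> smaller than half of the gain.\<close>

lemma large_on_line_beside_ascending_end:
  assumes H: "open H" "connected H" "periodic_set H" "path_connected (frontier H)" "right_half_plane R \<subseteq> H"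
      "\<And>z. z \<in> H \<Longrightarrow> - m < Re z" and y: "R < y"
    and f: "f holomorphic_on H" "\<And>z. z \<in> H \<Longrightarrow> - \<mu> \<le> Re (f z)" and \<beta>: "0 \<le> \<beta>"
    and X: "open X" "connected X" "X \<subseteq> H"
      "\<And>z. z \<in> X \<Longrightarrow> Re z < y \<and> 0 < Im z \<and> \<beta> - \<mu> \<le> Re (f z)"
    and ends: "\<And>s. \<exists>Y\<subseteq>X. connected Y \<and> \<not> bounded Y \<and> (\<forall>z\<in>Y. s < Im z)"
  shows "\<exists>w. Re w = y \<and> \<beta> / (2 * (y + 1 + m)) - \<mu> \<le> Re (f w)"
proof -
  have "Complex y 0 \<in> H" using H(5) y by (auto simp: right_half_plane_def)
  then have ym: "0 < y + m" using H(6)[of "Complex y 0"] by simp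
  define \<kappa> where "\<kappa> = 1 / (y + 1 + m)"
  have \<kappa>: "\<kappa> > 0" using ym by (simp add: \<kappa>_def)
  obtain Y0 where "Y0 \<subseteq> X" "\<not> bounded Y0" using ends by blast
  then obtain x0 where x0: "x0 \<in> X" by fastforce
  define e where "e = complex_of_real (y + 2)"
  have "e \<in> H" using H(5) y by (auto simp: right_half_plane_def e_def)
  moreover have "path_connected H" using H(1,2) connected_open_path_connected by blast
  ultimately obtain \<sigma> where \<sigma>: "path \<sigma>" "path_image \<sigma> \<subseteq> H" "pathstart \<sigma> = e" "pathfinish \<sigma> = x0"
    using x0 X(3) unfolding path_connected_def by blast
  obtain s1 where s1: "0 < s1" "\<And>z. z \<in> path_image \<sigma> \<Longrightarrow> norm z \<le> s1"
    using bounded_path_image[OF \<sigma>(1)] by (auto simp: bounded_pos)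
  define L where "L = max 1 (ln (8 / \<kappa>) / \<kappa>)"
  have "ln (8 / \<kappa>) \<le> \<kappa> * L" using \<kappa> by (simp add: L_def max_def field_simps)
  then have "exp (- \<kappa> * L) \<le> exp (- ln (8 / \<kappa>))" by simp
  also have "\<dots> = \<kappa> / 8" using \<kappa> by (simp add: exp_minus)
  finally have expL: "exp (- \<kappa> * L) \<le> \<kappa> / 8" .
  define t1 where "t1 = s1 + 1"
  define t2 where "t2 = t1 + 2 * L"
  have L: "1 \<le> L" by (simp add: L_def)
  obtain Y where Y: "Y \<subseteq> X" "connected Y" "\<not> bounded Y" "\<And>z. z \<in> Y \<Longrightarrow> t2 + 1 < Im z"
    using ends[of "t2 + 1"] by blast
  then obtain x1 where x1: "x1 \<in> Y" by fastforce
  have "path_connected X" using X(1,2) connected_open_path_connected by blast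
  then obtain q where q: "path q" "path_image q \<subseteq> X" "pathstart q = x0" "pathfinish q = x1"
    using x0 x1 Y(1) unfolding path_connected_def by blast
  have "\<beta> * (\<kappa> - 4 * exp (- \<kappa> * ((t2 - t1) / 2))) - \<mu> \<le> Re (f (Complex y ((t1 + t2) / 2)))"
  proof (rule lower_bound_beside_path[OF H(1,3-6) \<sigma>(1,2) _ \<sigma>(3) _ _ q(1) _ _ Y(2,3) _ _ _ _ y _ _ _ _ f _ \<beta> \<kappa>_def])
    show "\<bar>Im z\<bar> \<le> s1" if "z \<in> path_image \<sigma>" for z
      using s1(2)[OF that] abs_Im_le_cmod[of z] by linarith
    show "Re z < y \<and> t2 + 1 < Im z" if "z \<in> Y" for z using that X(4) Y by blast
  qed (use q X Y x1 s1 L \<sigma> in \<open>auto simp: e_def t1_def t2_def\<close>)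
  moreover have "(t2 - t1) / 2 = L" by (simp add: t2_def)
  ultimately have "\<beta> * (\<kappa> - 4 * exp (- \<kappa> * L)) - \<mu> \<le> Re (f (Complex y ((t1 + t2) / 2)))"
    by simp
  moreover have "\<beta> * (\<kappa> / 2) \<le> \<beta> * (\<kappa> - 4 * exp (- \<kappa> * L))"
    using expL \<beta> by (intro mult_left_mono) auto
  moreover have "\<beta> * (\<kappa> / 2) = \<beta> / (2 * (y + 1 + m))" by (simp add: \<kappa>_def)
  ultimately have "\<beta> / (2 * (y + 1 + m)) - \<mu> \<le> Re (f (Complex y ((t1 + t2) / 2)))" by linarith
  then show ?thesis by (intro exI[of _ "Complex y ((t1 + t2) / 2)"]) simp
qed


text \<open>A connected set that avoids the real axis lies above or below it. The second case is
  reduced to the first by complex conjugation.\<close>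

lemma large_on_line_beside_end:
  assumes H: "open H" "connected H" "periodic_set H" "path_connected (frontier H)" "right_half_plane R \<subseteq> H"
      "\<And>z. z \<in> H \<Longrightarrow> - m < Re z" and y: "R < y"
    and f: "f holomorphic_on H" "\<And>z. z \<in> H \<Longrightarrow> - \<mu> \<le> Re (f z)" and \<beta>: "0 \<le> \<beta>"
    and X: "open X" "connected X" "X \<subseteq> H"
      "\<And>z. z \<in> X \<Longrightarrow> Re z < y \<and> Im z \<noteq> 0 \<and> \<beta> - \<mu> \<le> Re (f z)"
    and ends: "\<And>s. \<exists>Y\<subseteq>X. connected Y \<and> \<not> bounded Y \<and> (\<forall>z\<in>Y. s < \<bar>Im z\<bar>)"
  shows "\<exists>w. Re w = y \<and> \<beta> / (2 * (y + 1 + m)) - \<mu> \<le> Re (f w)"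
proof -
  have conIm: "connected (Im ` X)" using X(2) by (intro connected_continuous_image continuous_intros)
  consider "\<forall>z\<in>X. 0 < Im z" | "\<forall>z\<in>X. Im z < 0"
  proof (rule ccontr)
    assume "\<not> thesis"
    with that obtain u v where "u \<in> X" "v \<in> X" "Im u \<le> 0" "0 \<le> Im v" by (meson not_le)
    then have "0 \<in> Im ` X"
      using conIm[unfolded connected_iff_interval] by (meson imageI)
    then show False using X(4) by auto
  qed
  then show ?thesis
  proof cases
    case 1
    show ?thesis
    proof (rule large_on_line_beside_ascending_end[OF H y f \<beta> X(1-3)])
      show "\<exists>Y\<subseteq>X. connected Y \<and> \<not> bounded Y \<and> (\<forall>z\<in>Y. s < Im z)" for s
        using ends[of s] 1 by (metis abs_of_pos subsetD)
    qed (use X(4) 1 in auto)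
  next
    case 2
    have inv: "cnj ` cnj ` A = A" for A by (auto simp: image_image)
    have bnd: "bounded (cnj ` A) \<longleftrightarrow> bounded A" for A by (simp add: bounded_iff)
    have con: "connected A \<Longrightarrow> connected (cnj ` A)" for A
      by (intro connected_continuous_image continuous_intros)
    have op: "open A \<Longrightarrow> open (cnj ` A)" for A
    proof -
      assume "open A"
      then have "open (cnj -` A)" by (intro open_vimage continuous_intros)
      moreover have "cnj -` A = cnj ` A" by (auto intro: image_eqI[where x = "cnj _"])
      ultimately show ?thesis by simp
    qed
    have lin: "linear cnj" "inj cnj" by (auto simp: bounded_linear.linear bounded_linear_cnj inj_on_def)
    have fr: "frontier (cnj ` H) = cnj ` frontier H"
    proof -
      have "closure (cnj ` H) = cnj ` closure H"
        using closure_injective_linear_image[OF lin] by metis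
      moreover have "interior (cnj ` H) = cnj ` H" "interior H = H"
        using op[OF H(1)] H(1) by (simp_all add: interior_open)
      ultimately show ?thesis by (simp add: frontier_def image_set_diff[OF lin(2)])
    qed
    have mem: "z \<in> cnj ` A \<longleftrightarrow> cnj z \<in> A" for z A
      by (metis complex_cnj_cnj imageE imageI)
    have "\<exists>w. Re w = y \<and> \<beta> / (2 * (y + 1 + m)) - \<mu> \<le> Re ((cnj \<circ> f \<circ> cnj) w)"
    proof (rule large_on_line_beside_ascending_end[where H = "cnj ` H" and X = "cnj ` X" and R = R])
      show "open (cnj ` H)" "connected (cnj ` H)" "open (cnj ` X)" "connected (cnj ` X)"
        using op con H X by auto
      show "periodic_set (cnj ` H)"
        unfolding periodic_set_def
      proof
        fix z
        have "cnj (z + two_pi_i) = cnj z + of_int (- 1) * two_pi_i" by simp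
        then show "z + two_pi_i \<in> cnj ` H \<longleftrightarrow> z \<in> cnj ` H"
          unfolding mem using periodic_set_of_int[OF H(3), of "cnj z" "- 1"] by metis
      qed
      show "path_connected (frontier (cnj ` H))" unfolding fr
        by (rule path_connected_continuous_image[OF _ H(4)]) (intro continuous_intros)
      show "right_half_plane R \<subseteq> cnj ` H"
        using H(5) by (auto simp: right_half_plane_def mem subset_iff)
      show "(cnj \<circ> f \<circ> cnj) holomorphic_on cnj ` H"
        using f(1) H(1) by (simp add: holomorphic_on_compose_cnj_cnj inv op)
      show "- m < Re z" "- \<mu> \<le> Re ((cnj \<circ> f \<circ> cnj) z)" if "z \<in> cnj ` H" for z
        using that H(6) f(2) by auto
      show "cnj ` X \<subseteq> cnj ` H" using X(3) by auto
      show "Re z < y \<and> 0 < Im z \<and> \<beta> - \<mu> \<le> Re ((cnj \<circ> f \<circ> cnj) z)" if "z \<in> cnj ` X" for z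
        using that X(4) 2 by auto
      show "\<exists>Y\<subseteq>cnj ` X. connected Y \<and> \<not> bounded Y \<and> (\<forall>z\<in>Y. s < Im z)" for s
      proof -
        obtain Y where Y: "Y \<subseteq> X" "connected Y" "\<not> bounded Y" "\<forall>z\<in>Y. s < \<bar>Im z\<bar>" using ends by blast
        have "\<forall>z\<in>cnj ` Y. s < Im z" using Y(1,4) 2 by force
        then show ?thesis using Y con bnd by (intro exI[of _ "cnj ` Y"]) auto
      qed
    qed (use y \<beta> in auto)
    then show ?thesis by (metis comp_apply complex_cnj cnj.sel(1))
  qed
qed

section \<open>Tracts and inverse branches\<close>

text \<open>The number \<open>R\<close> fixes one of the right half-planes contained in the codomain.\<close>

locale log_transform =
  fixes V H :: "complex set" and F :: "complex \<Rightarrow> complex" and R :: real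
  assumes B_log: "B_log V H F"
    and half_plane_subset: "right_half_plane R \<subseteq> H"
begin

lemma codomain:
  shows "unbounded_jordan_domain H" "periodic_set H" "open H" "connected H"
  using B_log by (auto simp: B_log_def unbounded_jordan_domain_def)

lemma domain:
  shows "V \<noteq> {}" "open V" "periodic_set V" "bdd_below (Re ` V)"
  using B_log by (auto simp: B_log_def)

lemma mem_codomain: "R < Re w \<Longrightarrow> w \<in> H"
  using half_plane_subset by (auto simp: right_half_plane_def)

lemma F_periodic:
  assumes "z \<in> V" shows "F (z + of_int k * two_pi_i) = F z"
proof -
  have nat: "F (z + of_nat k * two_pi_i) = F z" if "z \<in> V" for k z
  proof (induction k)
    case (Suc k)
    have "z + of_nat (Suc k) * two_pi_i = (z + of_nat k * two_pi_i) + two_pi_i"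
      by (simp add: algebra_simps)
    moreover have "z + of_nat k * two_pi_i \<in> V"
      using periodic_set_of_nat[OF domain(3)] that by blast
    ultimately show ?case using Suc B_log by (metis B_log_def)
  qed simp
  show ?thesis
  proof (cases "k \<ge> 0")
    case True
    then show ?thesis using nat[OF assms, of "nat k"] by simp
  next
    case False
    have "z + of_int k * two_pi_i \<in> V" using periodic_set_of_int[OF domain(3)] assms by blast
    from nat[OF this, of "nat (- k)"] False show ?thesis by simp
  qed
qed

lemma tract:
  assumes "T \<in> components V"
  shows "unbounded_jordan_domain T" "T \<subseteq> V" "open T" "F holomorphic_on T" "bij_betw F T H"
    "filterlim F at_infinity (inf at_infinity (principal T))"
proof -
  show "unbounded_jordan_domain T" "F holomorphic_on T" "bij_betw F T H"
    "filterlim F at_infinity (inf at_infinity (principal T))"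
    using B_log assms by (auto simp: B_log_def conformal_isomorphism_fixing_infinity_def)
  show "T \<subseteq> V" "open T"
    using assms domain(2) by (auto simp: in_components_subset open_components)
qed

lemma tract_disjoint_translate:
  assumes "T \<in> components V" "k \<noteq> 0" "z \<in> T"
  shows "z + of_int k * two_pi_i \<notin> T"
  using B_log assms unfolding B_log_def by blast

lemma distinct_tracts_escape:
  assumes "\<And>n. u n \<in> V"
    and "\<And>m n. m \<noteq> n \<Longrightarrow> connected_component_set V (u m) \<noteq> connected_component_set V (u n)"
  shows "filterlim u at_infinity sequentially"
proof -
  have "\<forall>z :: nat \<Rightarrow> complex.
        (\<forall>n. z n \<in> V) \<and>
        (\<forall>m n. m \<noteq> n \<longrightarrow>
           connected_component_set V (z m) \<noteq> connected_component_set V (z n)) \<longrightarrow>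
        filterlim z at_infinity sequentially"
    using B_log unfolding B_log_def by (elim conjE)
  then show ?thesis using assms by simp
qed

lemma component_of_mem_tract:
  assumes "T \<in> components V" "z \<in> T"
  shows "connected_component_set V z = T"
  using assms by (metis components_iff connected_component_eq)

lemma ex_tract: "z \<in> V \<Longrightarrow> \<exists>T\<in>components V. z \<in> T"
  by (meson connected_component_in componentsI connected_component_refl_eq mem_Collect_eq)

lemma translate_tract:
  assumes "T \<in> components V"
  shows "(\<lambda>z. z + of_int k * two_pi_i) ` T \<in> components V"
proof -
  have sub: "x + of_int k * two_pi_i \<in> connected_component_set V (z + of_int k * two_pi_i)"
    if z: "z \<in> V" and x: "x \<in> connected_component_set V z" for x z k
  proof -
    have "(\<lambda>x. x + of_int k * two_pi_i) ` connected_component_set V z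
        \<subseteq> connected_component_set V (z + of_int k * two_pi_i)"
    proof (rule connected_component_maximal)
      show "connected ((\<lambda>x. x + of_int k * two_pi_i) ` connected_component_set V z)"
        by (intro connected_continuous_image continuous_intros connected_connected_component)
      show "(\<lambda>x. x + of_int k * two_pi_i) ` connected_component_set V z \<subseteq> V"
        using connected_component_subset[of V z] periodic_set_of_int[OF domain(3)] by blast
      show "z + of_int k * two_pi_i \<in> (\<lambda>x. x + of_int k * two_pi_i) ` connected_component_set V z"
        using z by simp
    qed
    then show ?thesis using x by blast
  qed
  obtain z where z: "z \<in> V" "T = connected_component_set V z" using assms by (auto simp: components_def)
  have zk: "z + of_int k * two_pi_i \<in> V" using z periodic_set_of_int[OF domain(3)] by blast
  have "(\<lambda>z. z + of_int k * two_pi_i) ` T = connected_component_set V (z + of_int k * two_pi_i)"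
  proof (intro set_eqI iffI)
    fix y assume y: "y \<in> connected_component_set V (z + of_int k * two_pi_i)"
    have "y + of_int (- k) * two_pi_i \<in> T" using sub[OF zk y, of "- k"] z(2) by simp
    then show "y \<in> (\<lambda>z. z + of_int k * two_pi_i) ` T"
      by (intro image_eqI[of _ _ "y + of_int (- k) * two_pi_i"]) simp_all
  qed (use sub[OF z(1)] z(2) in blast)
  then show ?thesis using componentsI[OF zk] by metis
qed

definition branch :: "complex set \<Rightarrow> complex \<Rightarrow> complex" where
  "branch T = the_inv_into T F"

lemma branch_in: "T \<in> components V \<Longrightarrow> w \<in> H \<Longrightarrow> branch T w \<in> T"
  unfolding branch_def using tract(5)[of T] by (auto simp: bij_betw_def the_inv_into_f_f)

lemma F_branch: "T \<in> components V \<Longrightarrow> w \<in> H \<Longrightarrow> F (branch T w) = w"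
  unfolding branch_def by (metis bij_betw_def f_the_inv_into_f tract(5))

lemma branch_F: "T \<in> components V \<Longrightarrow> z \<in> T \<Longrightarrow> branch T (F z) = z"
  unfolding branch_def by (metis bij_betw_def the_inv_into_f_f tract(5))

lemma F_in: "T \<in> components V \<Longrightarrow> z \<in> T \<Longrightarrow> F z \<in> H"
  by (meson bij_betwE tract(5))

lemma branch_holomorphic:
  assumes T: "T \<in> components V" shows "branch T holomorphic_on H"
proof -
  have inj: "inj_on F T" and im: "F ` T = H" using tract(5)[OF T] by (auto simp: bij_betw_def)
  obtain g where g: "g holomorphic_on F ` T" "\<And>z. z \<in> T \<Longrightarrow> g (F z) = z"
    by (rule holomorphic_has_inverse[OF tract(4)[OF T] tract(3)[OF T] inj]) blast
  have "g w = branch T w" if "w \<in> H" for w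
    using g(2)[OF branch_in[OF T that]] F_branch[OF T that] by simp
  then show ?thesis using g(1) im by (metis holomorphic_transform)
qed

text \<open>A disc of radius greater than \<open>\<pi>\<close> contains two points that differ by \<open>2\<pi>\<i>\<close>.\<close>

lemma no_disc_in_tract:
  assumes T: "T \<in> components V" shows "\<not> ball c 4 \<subseteq> T"
proof
  assume sub: "ball c 4 \<subseteq> T"
  have "c - \<i> * pi \<in> ball c 4" "c + \<i> * pi \<in> ball c 4"
    using pi_less_4 by (auto simp: dist_norm norm_mult)
  moreover have "c + \<i> * pi = (c - \<i> * pi) + of_int 1 * two_pi_i" by simp
  ultimately show False
    using tract_disjoint_translate[OF T, of 1 "c - \<i> * pi"] sub by (metis subsetD zero_neq_one)
qed

text \<open>Bloch's theorem with constant \<open>1/12\<close>, applied to the disc about \<open>w\<close> that touches the line \<open>Re = R\<close>: were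
  the derivative larger, the image would contain a disc of radius \<open>4\<close>. This is the usual expansion
  property of logarithmic transforms.\<close>

lemma deriv_branch_bound:
  assumes T: "T \<in> components V" and w: "R < Re w"
  shows "cmod (deriv (branch T) w) * (Re w - R) \<le> 48"
proof (rule ccontr)
  assume big: "\<not> ?thesis"
  define r where "r = Re w - R"
  have r: "0 < r" using w by (simp add: r_def)
  have sub: "ball w r \<subseteq> H"
  proof
    fix z assume "z \<in> ball w r"
    then have "cmod (w - z) < r" by (simp add: dist_norm)
    then have "Re w - Re z < r" using complex_Re_le_cmod[of "w - z"] by simp
    then show "z \<in> H" by (intro mem_codomain) (simp add: r_def)
  qed
  obtain b where "ball b 4 \<subseteq> branch T ` ball w r"
  proof (rule Bloch_general[of "branch T" "ball w r" w r 4])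
    show "branch T holomorphic_on ball w r"
      using branch_holomorphic[OF T] sub holomorphic_on_subset by blast
    show "w \<in> ball w r" using r by simp
    show "r \<le> dist w z" if "z \<in> frontier (ball w r)" for z
      using that r by (auto simp: frontier_ball)
    show "4 \<le> r * cmod (deriv (branch T) w) / 12" using big by (simp add: r_def mult.commute)
  qed (use that in blast)
  moreover have "branch T ` ball w r \<subseteq> T" using branch_in[OF T] sub by blast
  ultimately show False using no_disc_in_tract[OF T] by blast
qed

text \<open>The derivative bound \<open>48 / (Re w - R)\<close> is \<open>1/4\<close> at distance \<open>192\<close> from the line \<open>Re = R\<close>, and half-planes are convex.\<close>

lemma branch_contraction:
  assumes T: "T \<in> components V" and w: "R + 192 \<le> Re w" "R + 192 \<le> Re w'"
  shows "cmod (branch T w - branch T w') \<le> 1 / 4 * cmod (w - w')"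
proof (rule field_differentiable_bound[where S = "{z. R + 192 \<le> Re z}"])
  show "convex {z. R + 192 \<le> Re z}" by (rule convex_halfspace_Re_ge)
  fix z assume z: "z \<in> {z. R + 192 \<le> Re z}"
  then have zH: "z \<in> H" by (intro mem_codomain) auto
  show "(branch T has_field_derivative deriv (branch T) z) (at z within {z. R + 192 \<le> Re z})"
    using holomorphic_derivI[OF branch_holomorphic[OF T] codomain(3) zH] has_field_derivative_at_within by blast
  have "cmod (deriv (branch T) z) * 192 \<le> cmod (deriv (branch T) z) * (Re z - R)"
    using z by (intro mult_left_mono) auto
  then show "cmod (deriv (branch T) z) \<le> 1 / 4"
    using deriv_branch_bound[OF T, of z] z by simp
qed (use w in auto)

text \<open>If the tract had an unbounded part of bounded real part, points of this part could be moved by multiples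
  of \<open>2\<pi>\<i>\<close> into a bounded set, and infinitely many of the moved points would lie in different tracts. But
  tracts accumulate only at infinity.\<close>

lemma tract_bounded_to_left:
  assumes T: "T \<in> components V" shows "bounded (T \<inter> {z. Re z \<le> c})"
proof (rule ccontr)
  assume unb: "\<not> bounded (T \<inter> {z. Re z \<le> c})"
  obtain \<mu> where \<mu>: "\<And>z. z \<in> V \<Longrightarrow> \<mu> \<le> Re z"
    using domain(4) by (auto simp: bdd_below_def)
  \<comment> \<open>the number of the period that contains the height of \<open>z\<close>\<close>
  define K where "K z = \<lfloor>Im z / (2 * pi)\<rfloor>" for z
  have large: "\<exists>z\<in>T. Re z \<le> c \<and> int n < \<bar>K z\<bar>" for n
  proof (rule ccontr)
    assume neg: "\<not> ?thesis"
    have "cmod z \<le> \<bar>\<mu>\<bar> + \<bar>c\<bar> + 2 * pi * (real n + 1)" if z: "z \<in> T" "Re z \<le> c" for z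
    proof -
      have "\<bar>K z\<bar> \<le> int n" using neg z by force
      then have "\<bar>Im z / (2 * pi)\<bar> \<le> real n + 1" unfolding K_def by linarith
      then have "\<bar>Im z\<bar> \<le> 2 * pi * (real n + 1)" by (simp add: field_simps)
      moreover have "\<bar>Re z\<bar> \<le> \<bar>\<mu>\<bar> + \<bar>c\<bar>" using \<mu>[of z] z tract(2)[OF T] by force
      ultimately show ?thesis using cmod_le[of z] by linarith
    qed
    then show False using unb by (auto simp: bounded_iff)
  qed
  define z where "z = rec_nat (SOME z. z \<in> T \<and> Re z \<le> c) (\<lambda>n x. SOME z. z \<in> T \<and> Re z \<le> c \<and> \<bar>K x\<bar> < \<bar>K z\<bar>)"
  have z0: "z 0 \<in> T \<and> Re (z 0) \<le> c"
    unfolding z_def using large[of 0] by (simp) (rule someI_ex, blast)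
  have zS: "z (Suc n) \<in> T \<and> Re (z (Suc n)) \<le> c \<and> \<bar>K (z n)\<bar> < \<bar>K (z (Suc n))\<bar>" for n
  proof -
    have "\<exists>x. x \<in> T \<and> Re x \<le> c \<and> \<bar>K (z n)\<bar> < \<bar>K x\<bar>" using large[of "nat \<bar>K (z n)\<bar>"] by auto
    then have "(\<lambda>x. x \<in> T \<and> Re x \<le> c \<and> \<bar>K (z n)\<bar> < \<bar>K x\<bar>) (SOME x. x \<in> T \<and> Re x \<le> c \<and> \<bar>K (z n)\<bar> < \<bar>K x\<bar>)"
      by (rule someI_ex)
    then show ?thesis by (simp add: z_def)
  qed
  have zT: "z n \<in> T" "Re (z n) \<le> c" for n using z0 zS by (cases n; blast)+
  have "strict_mono (\<lambda>n. \<bar>K (z n)\<bar>)" using zS by (simp add: strict_mono_Suc_iff)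
  then have Kne: "K (z m) \<noteq> K (z n)" if "m \<noteq> n" for m n
    using that by (metis strict_mono_eq)
  define u where "u n = z n + of_int (- K (z n)) * two_pi_i" for n
  have uV: "u n \<in> V" for n
    unfolding u_def periodic_set_of_int[OF domain(3)] using zT tract(2)[OF T] by blast
  have comp: "connected_component_set V (u n) = (\<lambda>x. x + of_int (- K (z n)) * two_pi_i) ` T" for n
    by (rule component_of_mem_tract[OF translate_tract[OF T]]) (use zT in \<open>auto simp: u_def\<close>)
  have "connected_component_set V (u m) \<noteq> connected_component_set V (u n)" if mn: "m \<noteq> n" for m n
  proof
    assume "connected_component_set V (u m) = connected_component_set V (u n)"
    then have "u m \<in> (\<lambda>x. x + of_int (- K (z n)) * two_pi_i) ` T"
      using comp zT by (auto simp: u_def)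
    then obtain x where "x \<in> T" "z m + of_int (- K (z m)) * two_pi_i = x + of_int (- K (z n)) * two_pi_i"
      by (auto simp: u_def)
    then have "x + of_int (K (z m) - K (z n)) * two_pi_i = z m" by (simp add: algebra_simps)
    then show False
      using tract_disjoint_translate[OF T _ \<open>x \<in> T\<close>] Kne[OF mn] zT(1)[of m] by (metis right_minus_eq)
  qed
  then have lim: "filterlim u at_infinity sequentially" using distinct_tracts_escape uV by blast
  have u_le: "cmod (u n) \<le> \<bar>\<mu>\<bar> + \<bar>c\<bar> + 2 * pi" for n
  proof -
    have "Im (u n) = Im (z n) - 2 * pi * of_int (K (z n))" by (simp add: u_def)
    moreover have "of_int (K (z n)) \<le> Im (z n) / (2 * pi)" "Im (z n) / (2 * pi) < of_int (K (z n)) + 1"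
      unfolding K_def by linarith+
    ultimately have "\<bar>Im (u n)\<bar> \<le> 2 * pi" by (simp add: field_simps)
    moreover have "\<bar>Re (u n)\<bar> \<le> \<bar>\<mu>\<bar> + \<bar>c\<bar>"
      using \<mu>[OF uV[of n]] zT(2)[of n] by (simp add: u_def)
    ultimately show ?thesis using cmod_le[of "u n"] by linarith
  qed
  have ev: "\<forall>\<^sub>F n in sequentially. \<bar>\<mu>\<bar> + \<bar>c\<bar> + 2 * pi + 1 \<le> cmod (u n)"
  proof -
    have "0 < \<bar>\<mu>\<bar> + \<bar>c\<bar> + 2 * pi + 1" using pi_gt_zero by linarith
    then show ?thesis using lim unfolding filterlim_at_infinity[OF order_refl] by blast
  qed
  obtain n where "\<bar>\<mu>\<bar> + \<bar>c\<bar> + 2 * pi + 1 \<le> cmod (u n)"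
    using eventually_happens'[OF sequentially_bot ev] by blast
  then show False using u_le[of n] by linarith
qed

end

section \<open>Inverse branches on vertical lines\<close>

context log_transform
begin

lemma F_large_near_infinity:
  assumes T: "T \<in> components V"
  obtains r where "\<And>z. z \<in> T \<Longrightarrow> r \<le> cmod z \<Longrightarrow> c < cmod (F z)"
proof -
  have "\<forall>\<^sub>F z in inf at_infinity (principal T). \<bar>c\<bar> + 1 \<le> cmod (F z)"
    using tract(6)[OF T] unfolding filterlim_at_infinity[OF order_refl] by auto
  then obtain r where "\<And>z. r \<le> cmod z \<Longrightarrow> z \<in> T \<Longrightarrow> \<bar>c\<bar> + 1 \<le> cmod (F z)"
    unfolding eventually_inf_principal eventually_at_infinity by blast
  then show thesis using that[of r] by force
qed

text \<open>This replaces Caratheodory's theorem in the proof: it says that the end of the tract at infinity is seen by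
  the inverse branch \<open>f\<close> on every vertical line of the half-plane. Suppose that \<open>Re f \<le> b\<close> on the line. By
  Phragmen-Lindelof this holds everywhere to the right of it. The part of the tract far out is
  connected, and its image \<open>F ` C\<close> is an unbounded connected set on which \<open>Re f\<close> is large. Therefore it
  lies to the left of the line, in a vertical strip, and escapes upwards or downwards. But then \<open>Re f\<close>
  is also large at some point of the line.\<close>

lemma branch_unbounded_on_vertical_line:
  assumes T: "T \<in> components V" and y: "R < y"
  shows "\<exists>w. Re w = y \<and> b < Re (branch T w)"
proof (rule ccontr)
  assume neg: "\<not> ?thesis"
  define f where "f = branch T"
  have line: "Re (f w) \<le> b" if "Re w = y" for w using neg that by (force simp: f_def)
  have holf: "f holomorphic_on H" unfolding f_def by (rule branch_holomorphic[OF T])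
  have right: "Re (f w) \<le> b" if "y \<le> Re w" for w
  proof (rule phragmen_lindelof_right_half_plane[OF _ _ y line that])
    show "f holomorphic_on right_half_plane R"
      using holf half_plane_subset holomorphic_on_subset by blast
    show "cmod (deriv f w) * (Re w - R) \<le> 48" if "R < Re w" for w
      unfolding f_def by (rule deriv_branch_bound[OF T that])
  qed auto
  have frH: "path_connected (frontier H)" "frontier H \<noteq> {}"
    using path_connected_frontier_unbounded_jordan_domain[OF codomain(1)]
      frontier_unbounded_jordan_domain_homeomorphic_line[OF codomain(1)] by auto
  obtain m where m: "m > 0" "\<And>z. z \<in> H \<Longrightarrow> - m < Re z"
    using periodic_domain_bounded_to_left[OF codomain(3,4,2) half_plane_subset frH] by blast
  obtain \<mu>' where "\<And>z. z \<in> V \<Longrightarrow> \<mu>' \<le> Re z" using domain(4) by (auto simp: bdd_below_def)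
  then obtain \<mu> where \<mu>: "\<And>z. z \<in> T \<Longrightarrow> - \<mu> \<le> Re z"
    using tract(2)[OF T] by (metis minus_minus subsetD)
  have f\<mu>: "- \<mu> \<le> Re (f w)" if "w \<in> H" for w using \<mu> branch_in[OF T that] by (simp add: f_def)
  have yH: "Complex y 0 \<in> H" using y by (intro mem_codomain) simp
  have ym: "0 < y + m" using m(2)[OF yH] by simp
  have b\<mu>: "0 \<le> b + \<mu>" using f\<mu>[OF yH] line[of "Complex y 0"] by simp
  \<comment> \<open>large enough for the set \<open>X\<close> to avoid the line and for the estimate at the line to exceed \<open>b\<close>\<close>
  define \<beta> where "\<beta> = (2 * (y + 1 + m) + 1) * (b + \<mu> + 1)"
  have \<beta>1: "b + \<mu> < \<beta> / (2 * (y + 1 + m))" "b + \<mu> < \<beta>"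
  proof -
    have "b + \<mu> + 1 \<le> \<beta>" "2 * (y + 1 + m) * (b + \<mu> + 1) \<le> \<beta>"
      using b\<mu> mult_nonneg_nonneg[of "2 * (y + 1 + m)" "b + \<mu> + 1"] ym
      by (auto simp: \<beta>_def distrib_right)
    then show "b + \<mu> < \<beta>" by simp
    have "b + \<mu> + 1 \<le> \<beta> / (2 * (y + 1 + m))"
      using \<open>2 * (y + 1 + m) * (b + \<mu> + 1) \<le> \<beta>\<close> ym by (simp add: pos_le_divide_eq mult.commute)
    then show "b + \<mu> < \<beta> / (2 * (y + 1 + m))" by linarith
  qed
  obtain r1 where r1: "\<And>z. z \<in> T \<Longrightarrow> Re z \<le> \<beta> - \<mu> \<Longrightarrow> cmod z \<le> r1"
    using tract_bounded_to_left[OF T, of "\<beta> - \<mu>"] by (auto simp: bounded_iff)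
  \<comment> \<open>beyond \<open>r2\<close> the image is too large to be a real point of the strip\<close>
  obtain r2 where r2: "\<And>z. z \<in> T \<Longrightarrow> r2 \<le> cmod z \<Longrightarrow> \<bar>y\<bar> + m < cmod (F z)"
    using F_large_near_infinity[OF T] by blast
  obtain C r' where C: "open C" "connected C" "C \<subseteq> T" "\<And>z. z \<in> C \<Longrightarrow> max r1 r2 < cmod z"
    "\<And>z. z \<in> T \<Longrightarrow> r' < cmod z \<Longrightarrow> z \<in> C"
    using unbounded_jordan_domain_connected_at_infinity[OF tract(1)[OF T], of "max r1 r2"] by metis
  have contF: "continuous_on T F" using tract(4)[OF T] holomorphic_on_imp_continuous_on by blast
  have FC: "F z \<in> H" "Re (F z) < y" "\<beta> - \<mu> \<le> Re (f (F z))" "Im (F z) \<noteq> 0"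
    "\<bar>Re (F z)\<bar> \<le> \<bar>y\<bar> + m" if z: "z \<in> C" for z
  proof -
    have zT: "z \<in> T" using C(3) z by blast
    show H: "F z \<in> H" by (rule F_in[OF T zT])
    have "f (F z) = z" unfolding f_def by (rule branch_F[OF T zT])
    moreover have "\<beta> - \<mu> < Re z" using r1[OF zT] C(4)[OF z] by force
    ultimately show "\<beta> - \<mu> \<le> Re (f (F z))" by simp
    have "b < Re (f (F z))" using \<open>f (F z) = z\<close> \<open>\<beta> - \<mu> < Re z\<close> \<beta>1 by simp
    then show lt: "Re (F z) < y" using right[of "F z"] by linarith
    then show re: "\<bar>Re (F z)\<bar> \<le> \<bar>y\<bar> + m" using m(1) m(2)[OF H] by linarith
    show "Im (F z) \<noteq> 0"
    proof
      assume "Im (F z) = 0"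
      then have "cmod (F z) \<le> \<bar>y\<bar> + m" using re cmod_le[of "F z"] by simp
      then show False using r2[OF zT] C(4)[OF z] by force
    qed
  qed
  have "\<exists>w. Re w = y \<and> \<beta> / (2 * (y + 1 + m)) - \<mu> \<le> Re (f w)"
  proof (rule large_on_line_beside_end[OF codomain(3,4,2) frH(1) half_plane_subset m(2) y holf f\<mu>, where X = "F ` C"])
    show "0 \<le> \<beta>" using \<beta>1 b\<mu> by simp
    show "open (F ` C)"
    proof (rule open_mapping_thm3[OF _ C(1)])
      show "F holomorphic_on C" using tract(4)[OF T] C(3) holomorphic_on_subset by blast
      show "inj_on F C" using tract(5)[OF T] C(3) by (meson bij_betw_def inj_on_subset)
    qed
    show "connected (F ` C)"
      using contF C(2,3) connected_continuous_image continuous_on_subset by blast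
    show "F ` C \<subseteq> H" using FC by auto
    show "Re z < y \<and> Im z \<noteq> 0 \<and> \<beta> - \<mu> \<le> Re (f z)" if "z \<in> F ` C" for z
      using that FC by auto
    fix s
    obtain r3 where r3: "\<And>z. z \<in> T \<Longrightarrow> r3 \<le> cmod z \<Longrightarrow> \<bar>s\<bar> + \<bar>y\<bar> + m < cmod (F z)"
      using F_large_near_infinity[OF T] by blast
    obtain C' r'' where C': "connected C'" "C' \<subseteq> T" "\<And>z. z \<in> C' \<Longrightarrow> max r' r3 < cmod z"
      "\<And>z. z \<in> T \<Longrightarrow> r'' < cmod z \<Longrightarrow> z \<in> C'"
      using unbounded_jordan_domain_connected_at_infinity[OF tract(1)[OF T], of "max r' r3"] by metis
    have C'C: "C' \<subseteq> C" using C' C(5) by force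
    show "\<exists>Y\<subseteq>F ` C. connected Y \<and> \<not> bounded Y \<and> (\<forall>z\<in>Y. s < \<bar>Im z\<bar>)"
    proof (intro exI[of _ "F ` C'"] conjI ballI)
      show "F ` C' \<subseteq> F ` C" using C'C by blast
      show "connected (F ` C')"
        using contF C'(1,2) connected_continuous_image continuous_on_subset by blast
      show "\<not> bounded (F ` C')"
      proof
        assume "bounded (F ` C')"
        then obtain c where c: "\<And>z. z \<in> C' \<Longrightarrow> cmod (F z) \<le> c" by (auto simp: bounded_iff)
        obtain r4 where r4: "\<And>z. z \<in> T \<Longrightarrow> r4 \<le> cmod z \<Longrightarrow> c < cmod (F z)"
          using F_large_near_infinity[OF T] by blast
        obtain z where "z \<in> T" "max r'' r4 < cmod z"
          using unbounded_jordan_domain_unbounded[OF tract(1)[OF T]] by (meson bounded_iff not_le)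
        then show False using c[OF C'(4)[of z]] r4[of z] by force
      qed
      fix v assume "v \<in> F ` C'"
      then obtain z where z: "z \<in> C'" "v = F z" by blast
      have "\<bar>s\<bar> + \<bar>y\<bar> + m < cmod (F z)" using r3[of z] C'(2,3) z(1) by force
      moreover have "cmod (F z) \<le> \<bar>Re (F z)\<bar> + \<bar>Im (F z)\<bar>" by (rule cmod_le)
      moreover have "\<bar>Re (F z)\<bar> \<le> \<bar>y\<bar> + m" using FC(5) C'C z(1) by blast
      ultimately show "s < \<bar>Im v\<bar>" unfolding z(2) by linarith
    qed
  qed
  then show False using line \<beta>1 by fastforce
qed

text \<open>On the line \<open>Re w = y\<close> the real part of the branch is unbounded above, while at \<open>w = y\<close> it grows with
  slope at most \<open>1/4\<close>. The intermediate value theorem yields everything from \<open>y/2\<close> on.\<close>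

lemma branch_attains_real_parts:
  assumes T: "T \<in> components V"
  obtains y0 where "R + 200 \<le> y0" "0 \<le> y0"
    "\<And>x y. y0 \<le> y \<Longrightarrow> y / 2 \<le> x \<Longrightarrow> \<exists>w. Re w = y \<and> Re (branch T w) = x"
proof -
  \<comment> \<open>the edge of the half-plane of contraction\<close>
  define y1 where "y1 = R + 192"
  define f1 where "f1 = Re (branch T (of_real y1))"
  define y0 where "y0 = \<bar>R\<bar> + 200 + 4 * \<bar>f1\<bar> + \<bar>y1\<bar>"
  show thesis
  proof
    show "R + 200 \<le> y0" "0 \<le> y0" by (auto simp: y0_def)
    fix x y assume xy: "y0 \<le> y" "y / 2 \<le> x"
    have yR: "R + 192 \<le> y" "y1 \<le> y" using xy by (auto simp: y0_def y1_def)
    have "cmod (branch T (of_real y) - branch T (of_real y1)) \<le> 1 / 4 * cmod (of_real y - of_real y1 :: complex)"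
      by (rule branch_contraction[OF T]) (use yR in \<open>auto simp: y1_def\<close>)
    also have "cmod (of_real y - of_real y1 :: complex) = y - y1"
      using yR by (metis abs_of_nonneg diff_ge_0_iff_ge norm_of_real of_real_diff)
    finally have "cmod (branch T (of_real y) - branch T (of_real y1)) \<le> (y - y1) / 4" by simp
    moreover have "Re (branch T (of_real y)) - f1 \<le> cmod (branch T (of_real y) - branch T (of_real y1))"
      using complex_Re_le_cmod[of "branch T (of_real y) - branch T (of_real y1)"] by (simp add: f1_def)
    ultimately have fy: "Re (branch T (of_real y)) \<le> f1 + (y - y1) / 4" by linarith
    have low: "Re (branch T (of_real y)) \<le> x" 
    proof -
      have "4 * f1 - y1 \<le> y"
        using xy(1) abs_ge_self[of f1] abs_ge_minus_self[of y1] abs_ge_zero[of R]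
        unfolding y0_def by linarith
      then have "f1 + (y - y1) / 4 \<le> y / 2" by (simp add: field_simps)
      with fy xy(2) show ?thesis by linarith
    qed
    obtain w where w: "Re w = y" "x < Re (branch T w)"
      using branch_unbounded_on_vertical_line[OF T, of y x] yR by auto
    define I where "I = {w. Re w = y}"
    have "I \<subseteq> H" using yR by (auto simp: I_def intro: mem_codomain)
    then have "continuous_on I (\<lambda>w. Re (branch T w))"
      using holomorphic_on_imp_continuous_on[OF branch_holomorphic[OF T]]
      by (intro continuous_on_Re) (rule continuous_on_subset)
    moreover have "connected I"
    proof (rule convex_connected)
      show "convex I" by (auto simp: convex_def I_def simp flip: distrib_right)
    qed
    ultimately have "connected ((\<lambda>w. Re (branch T w)) ` I)" by (rule connected_continuous_image)
    moreover have "Re (branch T (of_real y)) \<in> (\<lambda>w. Re (branch T w)) ` I" by (auto simp: I_def)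
    moreover have "Re (branch T w) \<in> (\<lambda>w. Re (branch T w)) ` I" using w by (auto simp: I_def)
    ultimately have "x \<in> (\<lambda>w. Re (branch T w)) ` I"
      unfolding connected_iff_interval using low w(2) by (meson less_imp_le)
    then show "\<exists>w. Re w = y \<and> Re (branch T w) = x" by (auto simp: I_def)
  qed
qed

end

lemma ex_translate_close:
  assumes "Re z = Re v"
  shows "\<exists>k::int. cmod (z + of_int k * two_pi_i - v) \<le> pi"
proof
  define t where "t = (Im v - Im z) / (2 * pi)"
  have "\<bar>of_int (round t) - t\<bar> \<le> 1 / 2" by (rule of_int_round_abs_le)
  moreover have "z + of_int (round t) * two_pi_i - v = \<i> * of_real (2 * pi * (real_of_int (round t) - t))"
    using assms by (simp add: complex_eq_iff t_def field_simps)
  moreover have "cmod (\<i> * of_real (2 * pi * (real_of_int (round t) - t))) = 2 * pi * \<bar>of_int (round t) - t\<bar>"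
    by (simp only: norm_mult norm_ii norm_of_real abs_mult) simp
  ultimately show "cmod (z + of_int (round t) * two_pi_i - v) \<le> pi"
    by (simp only:) (simp add: field_simps)
qed

context log_transform
begin

text \<open>Translates of a single tract provide the point \<open>a\<close> close to any given \<open>v\<close>.\<close>

lemma ex_near_point_with_image_on_line:
  obtains y0 where "R + 200 \<le> y0" "0 \<le> y0"
    "\<And>v y. y0 \<le> y \<Longrightarrow> y / 2 \<le> Re v \<Longrightarrow>
       \<exists>T\<in>components V. \<exists>a\<in>T. Re a = Re v \<and> cmod (a - v) \<le> pi \<and> Re (F a) = y"
proof -
  obtain T where T: "T \<in> components V" using domain(1) ex_tract by blast
  obtain y0 where y0: "R + 200 \<le> y0" "0 \<le> y0"
    "\<And>x y. y0 \<le> y \<Longrightarrow> y / 2 \<le> x \<Longrightarrow> \<exists>w. Re w = y \<and> Re (branch T w) = x"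
    using branch_attains_real_parts[OF T] by blast
  show thesis
  proof (rule that[OF y0(1,2)])
    fix v y assume "y0 \<le> y" "y / 2 \<le> Re v"
    then obtain w where w: "Re w = y" "Re (branch T w) = Re v" using y0(3) by blast
    then obtain k where k: "cmod (branch T w + of_int k * two_pi_i - v) \<le> pi"
      using ex_translate_close by blast
    have wH: "w \<in> H" using w y0 \<open>y0 \<le> y\<close> by (intro mem_codomain) simp
    define a where "a = branch T w + of_int k * two_pi_i"
    have "branch T w \<in> V" using branch_in[OF T wH] tract(2)[OF T] by blast
    then have "F a = w" unfolding a_def using F_periodic F_branch[OF T wH] by simp
    moreover have "a \<in> (\<lambda>z. z + of_int k * two_pi_i) ` T" using branch_in[OF T wH] by (auto simp: a_def)
    moreover have "Re a = Re v" using w by (simp add: a_def)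
    ultimately show "\<exists>T\<in>components V. \<exists>a\<in>T. Re a = Re v \<and> cmod (a - v) \<le> pi \<and> Re (F a) = y"
      using k w(1) by (intro bexI[OF _ translate_tract[OF T, of k]] bexI[of _ a]) (auto simp: a_def)
  qed
qed

lemma pull_back_close:
  assumes T: "T \<in> components V" "a \<in> T" and "R + 192 \<le> Re (F a)" "R + 192 \<le> Re \<zeta>"
    and "cmod (\<zeta> - F a) \<le> c"
  obtains \<zeta>' where "\<zeta>' \<in> T" "F \<zeta>' = \<zeta>" "cmod (\<zeta>' - a) \<le> c / 4"
proof
  have H: "\<zeta> \<in> H" using assms by (intro mem_codomain) simp
  show "branch T \<zeta> \<in> T" "F (branch T \<zeta>) = \<zeta>" using branch_in F_branch T(1) H by auto
  show "cmod (branch T \<zeta> - a) \<le> c / 4"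
    using branch_contraction[OF T(1) assms(4,3)] branch_F[OF T] assms(5) by simp
qed

text \<open>If \<open>F a\<close> and \<open>a\<close> have the same real part, then some translate of \<open>a\<close> by a multiple of \<open>2\<pi>\<i>\<close> lies within \<open>\<pi>\<close> of \<open>F a\<close>.
  The corresponding translated inverse branch is a contraction of the disc of radius \<open>\<pi>\<close> about \<open>a\<close>.\<close>

lemma ex_near_fixed_point:
  assumes T: "T \<in> components V" "a \<in> T" and a: "Re (F a) = Re a" "R + 200 \<le> Re a"
  shows "\<exists>p\<in>T. \<exists>k::int. F p = p + of_int k * two_pi_i \<and> cmod (p - a) \<le> pi"
proof -
  obtain k where "cmod (a + of_int k * two_pi_i - F a) \<le> pi" using ex_translate_close a(1) by metis
  define \<phi> where "\<phi> \<zeta> = branch T (\<zeta> + of_int k * two_pi_i)" for \<zeta>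
  have Re_ge: "R + 192 \<le> Re (\<zeta> + of_int k * two_pi_i)" if "\<zeta> \<in> cball a pi" for \<zeta>
  proof -
    have "Re (a - \<zeta>) \<le> pi" using that complex_Re_le_cmod[of "a - \<zeta>"] by (simp add: dist_norm)
    then show ?thesis using a(2) pi_less_4 by simp
  qed
  have "\<exists>!p. p \<in> cball a pi \<and> \<phi> p = p"
  proof (rule Banach_fix)
    show "complete (cball a pi)" by (simp add: complete_eq_closed)
    show "cball a pi \<noteq> {}" by simp
    show "0 \<le> (1 / 4 :: real)" "1 / 4 < (1 :: real)" by auto
    show "\<phi> ` cball a pi \<subseteq> cball a pi"
    proof
      fix u assume "u \<in> \<phi> ` cball a pi"
      then obtain \<zeta> where \<zeta>: "\<zeta> \<in> cball a pi" "u = \<phi> \<zeta>" by blast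
      have "cmod (\<phi> \<zeta> - branch T (F a)) \<le> 1 / 4 * cmod (\<zeta> + of_int k * two_pi_i - F a)"
        unfolding \<phi>_def by (rule branch_contraction[OF T(1) Re_ge[OF \<zeta>(1)]]) (use a in simp)
      also have "\<zeta> + of_int k * two_pi_i - F a = (\<zeta> - a) + (a + of_int k * two_pi_i - F a)" by simp
      also have "cmod \<dots> \<le> pi + pi"
        using \<zeta>(1) \<open>cmod (a + of_int k * two_pi_i - F a) \<le> pi\<close>
        by (intro norm_triangle_mono) (auto simp: dist_norm norm_minus_commute)
      finally have "cmod (\<phi> \<zeta> - a) \<le> 1 / 4 * (pi + pi)" using branch_F[OF T] by simp
      moreover have "1 / 4 * (pi + pi) \<le> pi" using pi_ge_zero by simp
      ultimately have "cmod (\<phi> \<zeta> - a) \<le> pi" by linarith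
      then show "u \<in> cball a pi" using \<zeta>(2) by (simp add: dist_norm norm_minus_commute)
    qed
    show "dist (\<phi> \<zeta>) (\<phi> \<zeta>') \<le> 1 / 4 * dist \<zeta> \<zeta>'" if "\<zeta> \<in> cball a pi" "\<zeta>' \<in> cball a pi" for \<zeta> \<zeta>'
      using branch_contraction[OF T(1) Re_ge[OF that(1)] Re_ge[OF that(2)]] by (simp add: \<phi>_def dist_norm)
  qed
  then obtain p where p: "p \<in> cball a pi" "\<phi> p = p" by blast
  have H: "p + of_int k * two_pi_i \<in> H" using Re_ge[OF p(1)] by (intro mem_codomain) simp
  have "p \<in> T" "F p = p + of_int k * two_pi_i"
    using branch_in[OF T(1) H] F_branch[OF T(1) H] p(2) by (auto simp: \<phi>_def)
  then show ?thesis using p(1) by (force simp: dist_norm norm_minus_commute)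
qed

text \<open>Let \<open>E\<close> be a set that is closed under the preimages of its points with real part at least \<open>Q\<close>, and that contains
  the points \<open>p\<close> of large real part which \<open>F\<close> fixes modulo \<open>2\<pi>\<i>\<close>. Near a point \<open>v\<close> with
  \<open>Re v \<ge> \<rho> + 8\<close> there is such a \<open>p\<close>. Otherwise there is a point near \<open>v\<close> whose image has twice the real part of \<open>v\<close>, and one
  pulls back what has been found near that image. The distance \<open>8\<close>
  leaves room for two errors of at most \<open>\<pi>\<close> each. It is essential that \<open>x0\<close> is chosen before \<open>\<rho>\<close>.\<close>

lemma backward_invariant_set_accumulates:
  obtains x0 where "R + 200 \<le> x0" "0 \<le> x0"
    "\<And>E Q \<rho> v. \<lbrakk>x0 \<le> Q; Q + 8 \<le> Re v;
       \<And>p k. p \<in> V \<Longrightarrow> F p = p + of_int k * two_pi_i \<Longrightarrow> Q \<le> Re p \<Longrightarrow> \<rho> \<le> Re p \<Longrightarrow> p \<in> E;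
       \<And>z. z \<in> V \<Longrightarrow> F z \<in> E \<Longrightarrow> Q \<le> Re (F z) \<Longrightarrow> z \<in> E\<rbrakk>
       \<Longrightarrow> \<exists>\<zeta>\<in>E. cmod (\<zeta> - v) \<le> 8"
proof -
  obtain y0 where y0: "R + 200 \<le> y0" "0 \<le> y0"
    and near: "\<And>v y. y0 \<le> y \<Longrightarrow> y / 2 \<le> Re v \<Longrightarrow>
       \<exists>T\<in>components V. \<exists>a\<in>T. Re a = Re v \<and> cmod (a - v) \<le> pi \<and> Re (F a) = y"
    using ex_near_point_with_image_on_line by blast
  show thesis
  proof (rule that[OF y0])
    fix E Q \<rho> v assume Q: "y0 \<le> Q" and v: "Q + 8 \<le> Re v"
      and fixed: "\<And>p k. p \<in> V \<Longrightarrow> F p = p + of_int k * two_pi_i \<Longrightarrow> Q \<le> Re p \<Longrightarrow> \<rho> \<le> Re p \<Longrightarrow> p \<in> E"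
      and pull: "\<And>z. z \<in> V \<Longrightarrow> F z \<in> E \<Longrightarrow> Q \<le> Re (F z) \<Longrightarrow> z \<in> E"
    have climb: "Q + 8 \<le> Re v \<Longrightarrow> \<rho> + 8 \<le> Re v * 2 ^ n \<Longrightarrow> \<exists>\<zeta>\<in>E. cmod (\<zeta> - v) \<le> 8" for n v
    proof (induction n arbitrary: v)
      case 0
      then obtain T a where Ta: "T \<in> components V" "a \<in> T" "Re a = Re v" "cmod (a - v) \<le> pi" "Re (F a) = Re v"
        using near[of "Re v" v] Q y0 by auto
      have "Re (F a) = Re a" "R + 200 \<le> Re a" using Ta(3,5) 0 Q y0 by auto
      then obtain p k where p: "p \<in> T" "F p = p + of_int k * two_pi_i" "cmod (p - a) \<le> pi"
        using ex_near_fixed_point[OF Ta(1,2)] by blast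
      have d: "cmod (p - v) \<le> 8"
        using norm_triangle_ineq[of "p - a" "a - v"] p(3) Ta(4) pi_less_4 by simp
      then have "Re (v - p) \<le> 8" using complex_Re_le_cmod[of "v - p"] by (simp add: norm_minus_commute)
      then have "Q \<le> Re p" "\<rho> \<le> Re p" using 0 by auto
      then show ?case using fixed[OF _ p(2)] tract(2)[OF Ta(1)] p(1) d by blast
    next
      case (Suc n)
      then obtain T a where Ta: "T \<in> components V" "a \<in> T" "Re a = Re v" "cmod (a - v) \<le> pi" "Re (F a) = 2 * Re v"
        using near[of "2 * Re v" v] Q y0 by auto
      have "Q + 8 \<le> Re (F a)" "\<rho> + 8 \<le> Re (F a) * 2 ^ n" using Ta(5) Suc.prems Q y0 by (auto simp: mult_ac)
      from Suc.IH[OF this] obtain \<zeta> where \<zeta>: "\<zeta> \<in> E" "cmod (\<zeta> - F a) \<le> 8" by blast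
      have "Re (F a - \<zeta>) \<le> 8" using \<zeta>(2) complex_Re_le_cmod[of "F a - \<zeta>"] by (simp add: norm_minus_commute)
      then have Q\<zeta>: "Q \<le> Re \<zeta>" using \<open>Q + 8 \<le> Re (F a)\<close> by simp
      then have "R + 192 \<le> Re (F a)" "R + 192 \<le> Re \<zeta>"
        using \<open>Q + 8 \<le> Re (F a)\<close> Q y0 by auto
      then obtain \<zeta>' where \<zeta>': "\<zeta>' \<in> T" "F \<zeta>' = \<zeta>" "cmod (\<zeta>' - a) \<le> 8 / 4"
        by (rule pull_back_close[OF Ta(1,2) _ _ \<zeta>(2)])
      have "\<zeta>' \<in> E" using pull[of \<zeta>'] \<zeta>' \<zeta>(1) Q\<zeta> tract(2)[OF Ta(1)] by auto
      moreover have "cmod (\<zeta>' - v) \<le> 8"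
        using norm_triangle_ineq[of "\<zeta>' - a" "a - v"] \<zeta>'(3) Ta(4) pi_less_4 by simp
      ultimately show ?case by blast
    qed
    have "0 < Re v" using v Q y0 by simp
    then obtain n where "(\<rho> + 8) / Re v < 2 ^ n" using real_arch_pow[of 2] by auto
    then have "\<rho> + 8 \<le> Re v * 2 ^ n" using \<open>0 < Re v\<close> by (simp add: field_simps)
    then show "\<exists>\<zeta>\<in>E. cmod (\<zeta> - v) \<le> 8" using climb v by blast
  qed
qed

end

section \<open>Orbits in the Julia set\<close>

context log_transform
begin

text \<open>Tracts accumulate only at infinity, so a convergent sequence visits finitely many of them.\<close>

lemma subsequence_in_one_tract:
  assumes v: "\<And>n. v n \<in> V" "v \<longlonglongrightarrow> z"
  obtains T s where "T \<in> components V" "strict_mono (s :: nat \<Rightarrow> nat)" "\<And>n. v (s n) \<in> T"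
proof -
  define c where "c n = connected_component_set V (v n)" for n
  have "finite (range c)"
  proof (rule ccontr)
    assume inf: "infinite (range c)"
    obtain S where S: "inj_on c S" "c ` S = range c"
      using subset_image_inj[of "range c" c UNIV] by auto
    then have infS: "infinite S" using inf by (metis finite_imageI)
    define s where "s = enumerate S"
    have s: "strict_mono s" "\<And>n. s n \<in> S"
      using infS by (auto simp: s_def strict_mono_enumerate enumerate_in_set)
    have "filterlim (v \<circ> s) at_infinity sequentially"
    proof (rule distinct_tracts_escape)
      show "connected_component_set V ((v \<circ> s) m) \<noteq> connected_component_set V ((v \<circ> s) n)" if "m \<noteq> n" for m n
        using S(1) s that by (metis c_def comp_apply inj_onD strict_mono_eq)
    qed (use v in simp)
    moreover have "(v \<circ> s) \<longlonglongrightarrow> z" using v(2) s(1) by (rule LIMSEQ_subseq_LIMSEQ)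
    ultimately show False
      using not_tendsto_and_filterlim_at_infinity[OF sequentially_bot] by blast
  qed
  then obtain n0 where "infinite {n \<in> UNIV. c n = c n0}"
    using pigeonhole_infinite[of UNIV c] by auto
  then have inf: "infinite {n. c n = c n0}" by simp
  show thesis
  proof (rule that[of "c n0" "enumerate {n. c n = c n0}"])
    show "c n0 \<in> components V" unfolding c_def using v(1) by (rule componentsI)
    show "strict_mono (enumerate {n. c n = c n0})" using inf by (rule strict_mono_enumerate)
    fix n
    have "c (enumerate {n. c n = c n0} n) = c n0" using enumerate_in_set[OF inf, of n] by simp
    then show "v (enumerate {n. c n = c n0} n) \<in> c n0"
      unfolding c_def using v(1) connected_component_refl_eq by fastforce
  qed
qed

text \<open>At a boundary point of the domain the boundary value of \<open>F\<close> is not in \<open>H\<close>, since the inverse branches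
  are continuous on \<open>H\<close>.\<close>

lemma ext_dom_imp_domain:
  assumes z: "z \<in> ext_dom V F" "R < Re (ext V F z)"
  shows "z \<in> V"
proof (rule ccontr)
  assume nz: "z \<notin> V"
  with z(1) obtain l where zl: "z \<in> closure V" "(F \<longlongrightarrow> l) (at z within V)" by (auto simp: ext_dom_def)
  have isl: "z islimpt V" using zl(1) nz by (simp add: closure_def)
  then have nontriv: "at z within V \<noteq> bot" by (simp add: trivial_limit_within)
  have "ext V F z = l" using nz tendsto_Lim[OF nontriv zl(2)] by (simp add: ext_def)
  then have l: "l \<in> H" using z(2) by (intro mem_codomain) simp
  obtain v where v: "\<And>n. v n \<in> V - {z}" "v \<longlonglongrightarrow> z" using isl by (auto simp: islimpt_sequential)
  obtain T s where T: "T \<in> components V" and s: "strict_mono (s :: nat \<Rightarrow> nat)" "\<And>n. v (s n) \<in> T"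
    using subsequence_in_one_tract[of v z] v by blast
  have lim: "(v \<circ> s) \<longlonglongrightarrow> z" using v(2) s(1) by (rule LIMSEQ_subseq_LIMSEQ)
  have "filterlim (v \<circ> s) (at z within V) sequentially"
    using lim v(1) by (auto simp: filterlim_at)
  then have "(\<lambda>n. F ((v \<circ> s) n)) \<longlonglongrightarrow> l" using zl(2) filterlim_compose by blast
  moreover have "isCont (branch T) l"
    using holomorphic_on_imp_continuous_on[OF branch_holomorphic[OF T]] codomain(3) l
      continuous_on_eq_continuous_at by blast
  ultimately have "(\<lambda>n. branch T (F ((v \<circ> s) n))) \<longlonglongrightarrow> branch T l"
    using isCont_tendsto_compose by blast
  then have "(v \<circ> s) \<longlonglongrightarrow> branch T l" using branch_F[OF T s(2)] by (simp add: o_def)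
  then have "z = branch T l" using lim LIMSEQ_unique by blast
  then show False using nz branch_in[OF T l] tract(2)[OF T] by blast
qed

text \<open>For \<open>Q > R\<close> every image of \<open>z\<close> lies in \<open>H\<close>, so by the preceding lemma the orbit stays in the open set \<open>V\<close>, where
  the extension is \<open>F\<close> itself.\<close>

lemma J_above_iff:
  assumes Q: "R < Q"
  shows "z \<in> J_above Q V F \<longleftrightarrow> (\<forall>n. (F ^^ n) z \<in> V) \<and> (\<forall>n\<ge>1. Q \<le> Re ((F ^^ n) z))"
proof
  assume z: "z \<in> J_above Q V F"
  have V: "(ext V F ^^ n) z \<in> V" for n
  proof (rule ext_dom_imp_domain)
    show "(ext V F ^^ n) z \<in> ext_dom V F" using z by (simp add: J_above_def J_def)
    have "Q \<le> Re ((ext V F ^^ Suc n) z)" using z by (simp add: J_above_def del: funpow.simps)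
    then show "R < Re (ext V F ((ext V F ^^ n) z))" using Q by simp
  qed
  have "(ext V F ^^ n) z = (F ^^ n) z" for n
  proof (induction n)
    case (Suc n)
    then have "(F ^^ n) z \<in> V" using V[of n] by simp
    then have "ext V F ((F ^^ n) z) = F ((F ^^ n) z)" by (simp add: ext_def)
    then show ?case using Suc by simp
  qed simp
  then show "(\<forall>n. (F ^^ n) z \<in> V) \<and> (\<forall>n\<ge>1. Q \<le> Re ((F ^^ n) z))"
    using V z by (auto simp: J_above_def)
next
  assume z: "(\<forall>n. (F ^^ n) z \<in> V) \<and> (\<forall>n\<ge>1. Q \<le> Re ((F ^^ n) z))"
  have eq: "(ext V F ^^ n) z = (F ^^ n) z" for n
  proof (induction n)
    case (Suc n)
    have "ext V F ((F ^^ n) z) = F ((F ^^ n) z)" using z by (simp add: ext_def)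
    then show ?case using Suc by simp
  qed simp
  show "z \<in> J_above Q V F" using z by (auto simp: J_above_def J_def eq ext_dom_def)
qed

lemma J_above_image:
  assumes "R < Q" "z \<in> J_above Q V F"
  shows "z \<in> V" "F z \<in> J_above Q V F" "Q \<le> Re (F z)" "ext V F z = F z"
proof -
  have z: "\<And>n. (F ^^ n) z \<in> V" "\<And>n. n \<ge> 1 \<Longrightarrow> Q \<le> Re ((F ^^ n) z)"
    using assms J_above_iff by auto
  show "z \<in> V" using z(1)[of 0] by simp
  then show "ext V F z = F z" by (simp add: ext_def)
  show "Q \<le> Re (F z)" using z(2)[of 1] by simp
  have eq: "(F ^^ n) (F z) = (F ^^ Suc n) z" for n by (metis comp_apply funpow_Suc_right)
  show "F z \<in> J_above Q V F"
    unfolding J_above_iff[OF assms(1)] eq 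
  proof (intro conjI allI impI)
    show "(F ^^ Suc n) z \<in> V" for n by (rule z(1))
    show "Q \<le> Re ((F ^^ Suc n) z)" for n by (rule z(2)) simp
  qed
qed

lemma J_above_preimage:
  assumes "R < Q" "z \<in> V" "F z \<in> J_above Q V F" "Q \<le> Re (F z)"
  shows "z \<in> J_above Q V F"
proof -
  have Fz: "\<And>n. (F ^^ n) (F z) \<in> V" "\<And>n. n \<ge> 1 \<Longrightarrow> Q \<le> Re ((F ^^ n) (F z))"
    using assms J_above_iff by auto
  have eq: "(F ^^ Suc n) z = (F ^^ n) (F z)" for n by (metis comp_apply funpow_Suc_right)
  have "(F ^^ n) z \<in> V" for n using Fz(1) assms(2) eq by (cases n) auto
  moreover have "Q \<le> Re ((F ^^ n) z)" if n: "n \<ge> 1" for n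
  proof -
    obtain k where k: "n = Suc k" using n by (cases n) auto
    show ?thesis using Fz(2)[of k] assms(4) unfolding k eq by (cases k) auto
  qed
  ultimately show ?thesis using J_above_iff[OF assms(1)] by blast
qed

lemma J_above_translate:
  assumes "R < Q" "z \<in> J_above Q V F"
  shows "z + of_int k * two_pi_i \<in> J_above Q V F"
proof (rule J_above_preimage[OF assms(1)])
  have "F (z + of_int k * two_pi_i) = F z" using F_periodic J_above_image(1)[OF assms] by blast
  then show "F (z + of_int k * two_pi_i) \<in> J_above Q V F" "Q \<le> Re (F (z + of_int k * two_pi_i))"
    using J_above_image[OF assms] by auto
  show "z + of_int k * two_pi_i \<in> V"
    using periodic_set_of_int[OF domain(3)] J_above_image(1)[OF assms] by blast
qed

lemma fixed_mod_period_in_J_above: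
  assumes "R < Q" "p \<in> V" "F p = p + of_int k * two_pi_i" "Q \<le> Re p"
  shows "p \<in> J_above Q V F"
proof -
  have "\<exists>j::int. (F ^^ n) p = p + of_int j * two_pi_i" for n
  proof (induction n)
    case (Suc n)
    then obtain j :: int where "(F ^^ n) p = p + of_int j * two_pi_i" by blast
    then have "(F ^^ Suc n) p = p + of_int k * two_pi_i" using F_periodic[OF assms(2), of j] assms(3) by simp
    then show ?case by blast
  qed (intro exI[of _ 0], simp)
  then have "(F ^^ n) p \<in> V \<and> Q \<le> Re ((F ^^ n) p)" for n
  proof -
    obtain j :: int where j: "(F ^^ n) p = p + of_int j * two_pi_i"
      using \<open>\<And>n. \<exists>j::int. (F ^^ n) p = p + of_int j * two_pi_i\<close> by blast
    show ?thesis
      unfolding j periodic_set_of_int[OF domain(3)] using assms(2,4) by simp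
  qed
  then show ?thesis using J_above_iff[OF assms(1)] by blast
qed

text \<open>The point found near \<open>F ^^ n\<close> of \<open>z\<close> is pulled back along the orbit of \<open>z\<close>. Each step divides the distance by
  \<open>4\<close> and, by backward invariance, stays in \<open>E\<close>.\<close>

lemma backward_invariant_set_dense:
  obtains x0 where "R < x0"
    "\<And>E Q \<rho>. \<lbrakk>x0 \<le> Q;
       \<And>p k. p \<in> V \<Longrightarrow> F p = p + of_int k * two_pi_i \<Longrightarrow> Q \<le> Re p \<Longrightarrow> \<rho> \<le> Re p \<Longrightarrow> p \<in> E;
       \<And>z. z \<in> V \<Longrightarrow> F z \<in> E \<Longrightarrow> Q \<le> Re (F z) \<Longrightarrow> z \<in> E\<rbrakk>
       \<Longrightarrow> J_above (Q + 8) V F \<subseteq> closure E"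
proof -
  obtain x0 where x0: "R + 200 \<le> x0" "0 \<le> x0"
    and acc: "\<And>E Q \<rho> v. \<lbrakk>x0 \<le> Q; Q + 8 \<le> Re v;
       \<And>p k. p \<in> V \<Longrightarrow> F p = p + of_int k * two_pi_i \<Longrightarrow> Q \<le> Re p \<Longrightarrow> \<rho> \<le> Re p \<Longrightarrow> p \<in> E;
       \<And>z. z \<in> V \<Longrightarrow> F z \<in> E \<Longrightarrow> Q \<le> Re (F z) \<Longrightarrow> z \<in> E\<rbrakk>
       \<Longrightarrow> \<exists>\<zeta>\<in>E. cmod (\<zeta> - v) \<le> 8"
    using backward_invariant_set_accumulates by blast
  show thesis
  proof (rule that)
    show "R < x0" using x0 by simp
    fix E Q \<rho> assume Q: "x0 \<le> Q"
      and fixed: "\<And>p k. p \<in> V \<Longrightarrow> F p = p + of_int k * two_pi_i \<Longrightarrow> Q \<le> Re p \<Longrightarrow> \<rho> \<le> Re p \<Longrightarrow> p \<in> E"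
      and pull: "\<And>z. z \<in> V \<Longrightarrow> F z \<in> E \<Longrightarrow> Q \<le> Re (F z) \<Longrightarrow> z \<in> E"
    have RQ: "R < Q + 8" using x0 Q by simp
    have step: "\<exists>\<zeta>\<in>E. cmod (\<zeta> - z) \<le> c / 4"
      if z: "z \<in> J_above (Q + 8) V F" and c: "c \<le> 8" and ex: "\<exists>\<zeta>\<in>E. cmod (\<zeta> - F z) \<le> c" for z c
    proof -
      obtain \<zeta> where \<zeta>: "\<zeta> \<in> E" "cmod (\<zeta> - F z) \<le> c" using ex by blast
      obtain T where T: "T \<in> components V" "z \<in> T" using ex_tract J_above_image(1)[OF RQ z] by blast
      have "Re (F z - \<zeta>) \<le> 8" using \<zeta>(2) c complex_Re_le_cmod[of "F z - \<zeta>"] by (simp add: norm_minus_commute)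
      then have Q\<zeta>: "Q \<le> Re \<zeta>" using J_above_image(3)[OF RQ z] by simp
      have "R + 192 \<le> Re (F z)" "R + 192 \<le> Re \<zeta>" using J_above_image(3)[OF RQ z] Q\<zeta> Q x0 by auto
      then obtain \<zeta>' where \<zeta>': "\<zeta>' \<in> T" "F \<zeta>' = \<zeta>" "cmod (\<zeta>' - z) \<le> c / 4"
        by (rule pull_back_close[OF T _ _ \<zeta>(2)])
      then have "\<zeta>' \<in> E" using pull[of \<zeta>'] \<zeta>(1) Q\<zeta> tract(2)[OF T(1)] by auto
      then show ?thesis using \<zeta>'(3) by blast
    qed
    have approx: "\<exists>\<zeta>\<in>E. cmod (\<zeta> - F z) \<le> 8 / 4 ^ n" if "z \<in> J_above (Q + 8) V F" for n z
      using that
    proof (induction n arbitrary: z)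
      case 0
      then show ?case using acc[OF Q J_above_image(3)[OF RQ] fixed pull] by simp
    next
      case (Suc n)
      have "(8 :: real) / 4 ^ n \<le> 8" by (simp add: divide_le_eq)
      then have "\<exists>\<zeta>\<in>E. cmod (\<zeta> - F z) \<le> 8 / 4 ^ n / 4"
        using step[OF J_above_image(2)[OF RQ Suc.prems] _ Suc.IH[OF J_above_image(2)[OF RQ Suc.prems]]] by blast
      then show ?case by (simp add: mult.commute)
    qed
    show "J_above (Q + 8) V F \<subseteq> closure E"
    proof
      fix z assume z: "z \<in> J_above (Q + 8) V F"
      show "z \<in> closure E"
        unfolding closure_approachable
      proof (intro allI impI)
        fix e :: real assume "e > 0"
        obtain n where n: "8 / e < 4 ^ n" using real_arch_pow[of 4] by auto
        have "(8 :: real) / 4 ^ n \<le> 8" by (simp add: divide_le_eq)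
        then obtain \<zeta> where "\<zeta> \<in> E" "cmod (\<zeta> - z) \<le> 8 / 4 ^ n / 4"
          using step[OF z _ approx[OF z, of n]] by blast
        moreover have "(8::real) / 4 ^ n / 4 < e"
        proof -
          have "(8::real) / 4 ^ n < e" using n \<open>e > 0\<close> by (simp add: field_simps)
          moreover have "(8::real) / 4 ^ n / 4 \<le> 8 / 4 ^ n" by (simp add: divide_right_mono)
          ultimately show ?thesis by (rule order.strict_trans1[rotated])
        qed
        ultimately show "\<exists>y\<in>E. dist y z < e" by (auto simp: dist_norm intro!: bexI[of _ \<zeta>])
      qed
    qed
  qed
qed

end

lemma J_above_antimono: "Q \<le> Q' \<Longrightarrow> J_above Q' V F \<subseteq> J_above Q V F"
  unfolding J_above_def by force

lemma admissible_semiconjugacyD: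
  assumes "admissible_semiconjugacy Q V F W G \<Phi> P" "z \<in> J_above Q V F"
  shows "P (ext V F z) = ext W G (P z)" "P (z + two_pi_i) = P z + two_pi_i"
    "\<exists>T\<in>components W. P z \<in> T \<and> \<Phi> z \<in> T"
  using assms by (auto simp: admissible_semiconjugacy_def)

lemma semiconjugacy_translate:
  assumes F: "log_transform V H F R" and Q: "R < Q1" "Q \<le> Q1"
    and P: "admissible_semiconjugacy Q V F W G \<Phi> P" and z: "z \<in> J_above Q1 V F"
  shows "P (z + of_int k * two_pi_i) = P z + of_int k * two_pi_i"
proof -
  interpret F: log_transform V H F R by (rule F)
  have nat: "P (z + of_nat n * two_pi_i) = P z + of_nat n * two_pi_i" if "z \<in> J_above Q1 V F" for z n
  proof (induction n)
    case (Suc n)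
    have "z + of_nat n * two_pi_i \<in> J_above Q1 V F"
      using F.J_above_translate[OF Q(1) that, of "int n"] by simp
    then have "z + of_nat n * two_pi_i \<in> J_above Q V F" using J_above_antimono[OF Q(2)] by blast
    from admissible_semiconjugacyD(2)[OF P this] Suc show ?case by (simp add: algebra_simps)
  qed simp
  show ?thesis
  proof (cases "k \<ge> 0")
    case True
    then show ?thesis using nat[OF z, of "nat k"] by simp
  next
    case False
    have "z + of_int k * two_pi_i \<in> J_above Q1 V F" by (rule F.J_above_translate[OF Q(1) z])
    from nat[OF this, of "nat (- k)"] False show ?thesis by simp
  qed
qed

text \<open>A translation moves \<open>P z\<close> close to the real axis. The value at the translated point is large, because that point
  is far from the origin when \<open>Re z\<close> is large. So \<open>Re (P z)\<close> is large in modulus, and real parts are bounded below on \<open>W\<close>. The bound \<open>\<rho>\<close> depends on \<open>P\<close>.\<close>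

lemma semiconjugacy_Re_large:
  assumes F: "log_transform V H F R" and W: "bdd_below (Re ` W)" and Q: "R < Q1" "Q \<le> Q1"
    and P: "admissible_semiconjugacy Q V F W G \<Phi> P"
  obtains \<rho> where "\<And>z. z \<in> J_above Q1 V F \<Longrightarrow> \<rho> \<le> Re z \<Longrightarrow> K \<le> Re (P z)"
proof -
  interpret F: log_transform V H F R by (rule F)
  obtain \<mu> where \<mu>: "\<And>w. w \<in> W \<Longrightarrow> \<mu> \<le> Re w" using W by (auto simp: bdd_below_def)
  define b where "b = \<bar>K\<bar> + \<bar>\<mu>\<bar> + 4 + 1"
  have "filterlim P at_infinity (inf at_infinity (principal (J_above Q V F)))"
    using P by (simp add: admissible_semiconjugacy_def)
  moreover have "0 < b" by (simp add: b_def)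
  ultimately have "\<forall>\<^sub>F z in inf at_infinity (principal (J_above Q V F)). b \<le> cmod (P z)"
    unfolding filterlim_at_infinity[OF order_refl] by blast
  then obtain \<rho> where \<rho>: "\<And>z. \<rho> \<le> cmod z \<Longrightarrow> z \<in> J_above Q V F \<Longrightarrow> b \<le> cmod (P z)"
    unfolding eventually_inf_principal eventually_at_infinity by blast
  show thesis
  proof
    fix z assume z: "z \<in> J_above Q1 V F" "\<rho> \<le> Re z"
    obtain k :: int where k: "cmod (P z + of_int k * two_pi_i - of_real (Re (P z))) \<le> pi"
      using ex_translate_close[of "P z" "of_real (Re (P z))"] by auto
    define z' where "z' = z + of_int k * two_pi_i"
    have z': "z' \<in> J_above Q1 V F" unfolding z'_def by (rule F.J_above_translate[OF Q(1) z(1)])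
    have "P z' = P z + of_int k * two_pi_i"
      unfolding z'_def by (rule semiconjugacy_translate[OF F Q P z(1)])
    moreover have "\<rho> \<le> cmod z'" using z(2) complex_Re_le_cmod[of z'] by (simp add: z'_def)
    then have "b \<le> cmod (P z')" using \<rho> z' J_above_antimono[OF Q(2)] by blast
    moreover have "cmod (P z + of_int k * two_pi_i) \<le> cmod (P z + of_int k * two_pi_i - of_real (Re (P z))) + cmod (of_real (Re (P z)) :: complex)"
      by (metis diff_add_cancel norm_triangle_ineq)
    ultimately have "b \<le> pi + \<bar>Re (P z)\<bar>" using k by simp
    moreover have "\<mu> \<le> Re (P z)"
    proof -
      have "z \<in> J_above Q V F" using z(1) J_above_antimono[OF Q(2)] by blast
      then have "P z \<in> W" using admissible_semiconjugacyD(3)[OF P] in_components_subset by blast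
      then show ?thesis by (rule \<mu>)
    qed
    ultimately show "K \<le> Re (P z)" using pi_less_4 unfolding b_def by linarith
  qed
qed

section \<open>Uniqueness of the semiconjugacy\<close>

text \<open>The set \<open>E\<close> where the two maps agree is backward invariant: if \<open>P\<^sub>1\<close> and \<open>P\<^sub>2\<close> agree at \<open>F z\<close>, then \<open>G\<close>
  takes the same value at \<open>P\<^sub>1 z\<close> and \<open>P\<^sub>2 z\<close>, and it is injective on the common tract of these points. It
  contains the points \<open>p\<close> of large real part with \<open>F p = p + 2\<pi>\<i>k\<close>: both values are fixed by the same
  contracting inverse branch of \<open>G\<close>, translated by \<open>2\<pi>\<i>k\<close>. By continuity the maps agree on the closure of \<open>E\<close>.\<close>

theorem corollary4p2:
  fixes V H W H' :: "complex set" and F G \<Phi> \<Psi> :: "complex \<Rightarrow> complex"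
  assumes "B_log V H F" and "B_log W H' G"
    and "qc_equivalent_via V F W G \<Phi> \<Psi>"
  shows "\<forall>Q>0. \<exists>Q'\<ge>Q. \<forall>P\<^sub>1 P\<^sub>2.
           admissible_semiconjugacy Q V F W G \<Phi> P\<^sub>1 \<longrightarrow>
           admissible_semiconjugacy Q V F W G \<Phi> P\<^sub>2 \<longrightarrow>
           (\<forall>z\<in>J_above Q' V F. P\<^sub>1 z = P\<^sub>2 z)"
proof (intro allI impI)
  fix Q :: real assume "Q > 0"
  obtain R R' where "right_half_plane R \<subseteq> H" "right_half_plane R' \<subseteq> H'"
    using assms(1,2) by (auto simp: B_log_def)
  then have locF: "log_transform V H F R" and locG: "log_transform W H' G R'"
    using assms(1,2) by (auto simp: log_transform_def)
  interpret F: log_transform V H F R by (rule locF)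
  interpret G: log_transform W H' G R' by (rule locG)
  obtain x0 where x0: "R < x0" and dense: "\<And>E Q \<rho>. \<lbrakk>x0 \<le> Q;
       \<And>p k. p \<in> V \<Longrightarrow> F p = p + of_int k * two_pi_i \<Longrightarrow> Q \<le> Re p \<Longrightarrow> \<rho> \<le> Re p \<Longrightarrow> p \<in> E;
       \<And>z. z \<in> V \<Longrightarrow> F z \<in> E \<Longrightarrow> Q \<le> Re (F z) \<Longrightarrow> z \<in> E\<rbrakk>
       \<Longrightarrow> J_above (Q + 8) V F \<subseteq> closure E"
    using F.backward_invariant_set_dense by blast
  define q where "q = max Q x0"
  have q: "R < q" "Q \<le> q" "x0 \<le> q" using x0 by (auto simp: q_def)
  have sub: "J_above q V F \<subseteq> J_above Q V F" using q(2) by (rule J_above_antimono)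
  show "\<exists>Q'\<ge>Q. \<forall>P\<^sub>1 P\<^sub>2.
           admissible_semiconjugacy Q V F W G \<Phi> P\<^sub>1 \<longrightarrow>
           admissible_semiconjugacy Q V F W G \<Phi> P\<^sub>2 \<longrightarrow>
           (\<forall>z\<in>J_above Q' V F. P\<^sub>1 z = P\<^sub>2 z)"
  proof (intro exI[of _ "q + 8"] conjI allI impI ballI)
    show "Q \<le> q + 8" using q by simp
    fix P\<^sub>1 P\<^sub>2 z
    assume P1: "admissible_semiconjugacy Q V F W G \<Phi> P\<^sub>1" and P2: "admissible_semiconjugacy Q V F W G \<Phi> P\<^sub>2"
      and z: "z \<in> J_above (q + 8) V F"
    define E where "E = {z \<in> J_above q V F. P\<^sub>1 z = P\<^sub>2 z}"
    have tract: "\<exists>T\<in>components W. P\<^sub>1 z \<in> T \<and> P\<^sub>2 z \<in> T" if z: "z \<in> J_above q V F" for z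
    proof -
      obtain T1 T2 where T: "T1 \<in> components W" "P\<^sub>1 z \<in> T1" "\<Phi> z \<in> T1" "T2 \<in> components W" "P\<^sub>2 z \<in> T2" "\<Phi> z \<in> T2"
        using admissible_semiconjugacyD(3)[OF P1] admissible_semiconjugacyD(3)[OF P2] z sub by blast
      then have "T1 = T2" by (metis G.component_of_mem_tract)
      then show ?thesis using T by blast
    qed
    have conj: "P (F z) = G (P z)" if P: "admissible_semiconjugacy Q V F W G \<Phi> P" and z: "z \<in> J_above q V F" for P z
    proof -
      have zQ: "z \<in> J_above Q V F" using z sub by blast
      have "P z \<in> W" using admissible_semiconjugacyD(3)[OF P zQ] in_components_subset by blast
      then show ?thesis
        using admissible_semiconjugacyD(1)[OF P zQ] F.J_above_image(4)[OF q(1) z] by (simp add: ext_def)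
    qed
    have pull: "z \<in> E" if z: "z \<in> V" "F z \<in> E" "q \<le> Re (F z)" for z
    proof -
      have zJ: "z \<in> J_above q V F" using F.J_above_preimage[OF q(1)] z by (simp add: E_def)
      then obtain T where T: "T \<in> components W" "P\<^sub>1 z \<in> T" "P\<^sub>2 z \<in> T" using tract by blast
      have "G (P\<^sub>1 z) = G (P\<^sub>2 z)" using conj[OF P1 zJ] conj[OF P2 zJ] z(2) by (simp add: E_def)
      then have "P\<^sub>1 z = P\<^sub>2 z" using G.branch_F[OF T(1,2)] G.branch_F[OF T(1,3)] by metis
      then show ?thesis using zJ by (simp add: E_def)
    qed
    obtain \<rho>1 where \<rho>1: "\<And>z. z \<in> J_above q V F \<Longrightarrow> \<rho>1 \<le> Re z \<Longrightarrow> R' + 192 \<le> Re (P\<^sub>1 z)"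
      using semiconjugacy_Re_large[OF locF G.domain(4) q(1,2) P1] by blast
    obtain \<rho>2 where \<rho>2: "\<And>z. z \<in> J_above q V F \<Longrightarrow> \<rho>2 \<le> Re z \<Longrightarrow> R' + 192 \<le> Re (P\<^sub>2 z)"
      using semiconjugacy_Re_large[OF locF G.domain(4) q(1,2) P2] by blast
    have fixed: "p \<in> E" if p: "p \<in> V" "F p = p + of_int k * two_pi_i" "q \<le> Re p" "max \<rho>1 \<rho>2 \<le> Re p" for p k
    proof -
      have pJ: "p \<in> J_above q V F" by (rule F.fixed_mod_period_in_J_above[OF q(1) p(1-3)])
      then obtain T where T: "T \<in> components W" "P\<^sub>1 p \<in> T" "P\<^sub>2 p \<in> T" using tract by blast
      have GP: "G (P p) = P p + of_int k * two_pi_i" if P: "admissible_semiconjugacy Q V F W G \<Phi> P" for P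
        using conj[OF P pJ] semiconjugacy_translate[OF locF q(1,2) P pJ] p(2) by simp
      have "cmod (G.branch T (G (P\<^sub>1 p)) - G.branch T (G (P\<^sub>2 p))) \<le> 1 / 4 * cmod (G (P\<^sub>1 p) - G (P\<^sub>2 p))"
        by (rule G.branch_contraction[OF T(1)]) (use GP[OF P1] GP[OF P2] \<rho>1[OF pJ] \<rho>2[OF pJ] p(4) in auto)
      then have "cmod (P\<^sub>1 p - P\<^sub>2 p) \<le> 1 / 4 * cmod (P\<^sub>1 p - P\<^sub>2 p)"
        using G.branch_F[OF T(1,2)] G.branch_F[OF T(1,3)] GP[OF P1] GP[OF P2] by simp
      then show ?thesis using pJ by (simp add: E_def)
    qed
    have "J_above (q + 8) V F \<subseteq> closure E" by (rule dense[OF q(3) fixed pull])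
    then have "z \<in> closure E" using z by blast
    then obtain e where e: "\<And>n. e n \<in> E" "e \<longlonglongrightarrow> z" by (auto simp: closure_sequential)
    have zQ: "z \<in> J_above Q V F" using z J_above_antimono[of Q "q + 8"] q by auto
    have eQ: "e n \<in> J_above Q V F" for n using e(1)[of n] sub by (auto simp: E_def)
    have lim: "(\<lambda>n. P (e n)) \<longlonglongrightarrow> P z" if P: "admissible_semiconjugacy Q V F W G \<Phi> P" for P
    proof -
      have "continuous_on (J_above Q V F) P" using P by (simp add: admissible_semiconjugacy_def)
      then show ?thesis using eQ e(2) zQ by (auto simp: continuous_on_sequentially o_def)
    qed
    have "(\<lambda>n. P\<^sub>1 (e n)) = (\<lambda>n. P\<^sub>2 (e n))" using e(1) by (auto simp: E_def)
    then show "P\<^sub>1 z = P\<^sub>2 z" using lim[OF P1] lim[OF P2] LIMSEQ_unique by metis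
  qed
qed

end
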